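(* Let $0<\alpha<1$ and let $K\subset[0,1]$ be a compact set with $\dim(K)\ge\alpha$. Let $C=\big\{\sum_{j=1}^\infty \epsilon_j 4^{-j}:\epsilon_j\in\{0,3\}\big\}$ and $$E_\alpha=\Big\{\big(x,\,(1-x)c_1+x c_2/2\big)\in\mathbb{R}^2 : (c_1,c_2)\in C\times C,\ x\in K\Big\}.$$ Then $$\dim(E_\alpha)\ \ge\ c+\frac{3\alpha}{2},\qquad\text{where } c=\frac{\log(8/3)}{\log 16}.$$
   Context: Throughout, $\dim$ denotes Hausdorff dimension. The set $C\subset[0,1]$ is the $1/2$-dimensional Cantor set of all sums $\sum_{j\ge1}\epsilon_j4^{-j}$ with each digit $\epsilon_j\in\{0,3\}$. Geometrically, $E_\alpha$ is the part lying over $x\in K$ of the union of all line segments joining $(0,c_1)$ to $(1,c_2/2)$ with $(c_1,c_2)\in C\times C$. *)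

theory Defs
  imports "HOL-Analysis.Analysis"
begin

(* The s-th power of the diameter, used for bounded sets only, since the library's real-valued
   "diameter" is meaningless on unbounded ones.  The empty set has weight 0 for every s and a
   nonempty set has weight 1 for s = 0 (in Isabelle, 0 powr 0 = 0), so that the 0-dimensional
   measure is the counting measure. *)
definition diam_pow :: "real \<Rightarrow> 'a::metric_space set \<Rightarrow> ennreal" where
  "diam_pow s U =
     (if U = {} then 0
      else if s = 0 then 1
      else ennreal (diameter U powr s))"

(* Covers are sequences of sets; finite covers are included since U i may be empty. *)
definition hausdorff_premeasure :: "real \<Rightarrow> real \<Rightarrow> 'a::metric_space set \<Rightarrow> ennreal" where
  "hausdorff_premeasure s \<delta> A =
     (INF U \<in> {U :: nat \<Rightarrow> 'a set. A \<subseteq> (\<Union>i. U i) \<and> (\<forall>i. bounded (U i) \<and> diameter (U i) \<le> \<delta>)}.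
        \<Sum>i. diam_pow s (U i))"

(* The premeasure increases as \<delta> decreases to 0, so the supremum is the limit. *)
definition hausdorff_measure :: "real \<Rightarrow> 'a::metric_space set \<Rightarrow> ennreal" where
  "hausdorff_measure s A = (SUP \<delta> \<in> {0<..}. hausdorff_premeasure s \<delta> A)"

(* Extended-real valued: in a general metric space the set of exponents may be empty,
   in which case the infimum is \<infinity>. *)
definition hausdorff_dim :: "'a::metric_space set \<Rightarrow> ereal" where
  "hausdorff_dim A = (INF s \<in> {s. 0 \<le> s \<and> hausdorff_measure s A = 0}. ereal s)"

(* The digit of index j stands at the place 4^(-(j+1)). *)
definition cantor_set :: "real set" where
  "cantor_set = {\<Sum>j. \<epsilon> j / 4 ^ Suc j |\<epsilon> :: nat \<Rightarrow> real. \<forall>j. \<epsilon> j \<in> {0, 3}}"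

(* The real plane is the type real \<times> real, whose library metric is the Euclidean one. *)
definition segment_set :: "real set \<Rightarrow> (real \<times> real) set" where
  "segment_set K =
     {(x, (1 - x) * c1 + x * c2 / 2) |x c1 c2. (c1, c2) \<in> cantor_set \<times> cantor_set \<and> x \<in> K}"

end

theory Submission
  imports Defs
begin

text \<open>
  The slice of \<open>E\<close> over \<open>x\<close> is \<open>(1 - x) C + (x / 2) C\<close>. Two estimates bound the number of
  quadruples of level-\<open>k\<close> points of \<open>C\<close> whose images collide at scale \<open>4 ^ (- k)\<close>. By the
  Cauchy--Schwarz inequality this number is, for each \<open>x\<close> away from 0 and 1, at most a constant
  times the additive energy \<open>6 ^ k\<close> of level-\<open>k\<close> digit sums, out of \<open>16 ^ k\<close> quadruples; so the
  slices have dimension at least \<open>2 * c\<close>, where \<open>4 powr (2 * c) = 16 / 6 = 8 / 3\<close>. By Kaufman's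
  argument (\<open>C \<times> C\<close> has dimension \<open>1 > \<alpha>\<close>) it is at most about \<open>16 ^ k * 4 powr (- k * \<alpha>)\<close> on average
  over a Frostman measure on \<open>K\<close>. Hence \<open>E\<close> has dimension at least \<open>\<alpha> + max (2 * c) \<alpha>\<close>, which is
  at least \<open>\<alpha> + (2 * c + \<alpha>) / 2\<close>. By compactness it suffices to consider finite covers, so all
  measures can be replaced by finite sums at one fine level \<open>n\<close>.
\<close>

section \<open>Frostman weights\<close>

text \<open>Greedy construction: the points are treated one at a time, and each receives the least
  slack left in the constraints containing it. This makes one of them tight, and a tight constraint
  stays tight because weights are nonnegative and no bound is ever exceeded.\<close>

lemma ex_saturating_weight:
  fixes c :: "'b \<Rightarrow> real" and R :: "'b \<Rightarrow> 'a set"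
  assumes "finite S" "finite T"
    and "\<And>t. t \<in> T \<Longrightarrow> 0 \<le> c t"
    and "\<And>x. x \<in> S \<Longrightarrow> \<exists>t\<in>T. x \<in> R t"
  shows "\<exists>w. (\<forall>x. 0 \<le> w x) \<and> (\<forall>t\<in>T. (\<Sum>x\<in>S \<inter> R t. w x) \<le> c t)
           \<and> (\<forall>x\<in>S. \<exists>t\<in>T. x \<in> R t \<and> (\<Sum>y\<in>S \<inter> R t. w y) = c t)"
  using assms(1,4)
proof (induction S rule: finite_induct)
  case empty
  show ?case using assms(3) by (intro exI[of _ "\<lambda>_. 0"]) auto
next
  case (insert x S)
  then obtain w where w: "\<And>x. 0 \<le> w x" "\<And>t. t \<in> T \<Longrightarrow> (\<Sum>x\<in>S \<inter> R t. w x) \<le> c t"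
    "\<And>x. x \<in> S \<Longrightarrow> \<exists>t\<in>T. x \<in> R t \<and> (\<Sum>y\<in>S \<inter> R t. w y) = c t"
    by (metis insertCI)
  define gap where "gap t = c t - (\<Sum>y\<in>S \<inter> R t. w y)" for t
  define G where "G = gap ` {t\<in>T. x \<in> R t}"
  define w' where "w' = w(x := Min G)"
  have G: "finite G" "G \<noteq> {}" using assms(2) insert.prems[of x] by (auto simp: G_def)
  have gap0: "0 \<le> gap t" if "t \<in> T" for t using w(2)[OF that] by (simp add: gap_def)
  have "0 \<le> Min G" using G gap0 by (auto simp: G_def)
  have old: "(\<Sum>y\<in>S \<inter> R t. w' y) = (\<Sum>y\<in>S \<inter> R t. w y)" for t
    using insert.hyps(2) by (intro sum.cong) (auto simp: w'_def)
  have new: "(\<Sum>y\<in>insert x S \<inter> R t. w' y) = (\<Sum>y\<in>S \<inter> R t. w y) + (if x \<in> R t then Min G else 0)" for t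
    using insert.hyps old[of t] by (simp add: w'_def)
  have le: "(\<Sum>y\<in>insert x S \<inter> R t. w' y) \<le> c t" if "t \<in> T" for t
  proof (cases "x \<in> R t")
    case True
    then have "Min G \<le> gap t" using G that by (auto simp: G_def intro!: Min_le)
    then show ?thesis unfolding new using True by (simp add: gap_def)
  next
    case False
    then show ?thesis unfolding new using w(2)[OF that] by simp
  qed
  have "\<exists>t\<in>T. y \<in> R t \<and> (\<Sum>y\<in>insert x S \<inter> R t. w' y) = c t" if "y \<in> insert x S" for y
  proof (cases "y = x")
    case True
    have "Min G \<in> G" using G by simp
    then obtain t where "t \<in> T" "x \<in> R t" "Min G = gap t" by (auto simp: G_def)
    then show ?thesis unfolding new using True by (intro bexI[of _ t]) (auto simp: gap_def)
  next
    case False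
    then have "y \<in> S" using that by simp
    then obtain t where t: "t \<in> T" "y \<in> R t" "(\<Sum>y\<in>S \<inter> R t. w y) = c t"
      using w(3) by blast
    then have "(\<Sum>y\<in>insert x S \<inter> R t. w' y) = c t"
      using le[of t] \<open>0 \<le> Min G\<close> unfolding new by (auto split: if_splits)
    then show ?thesis using t by blast
  qed
  moreover have "\<forall>y. 0 \<le> w' y" using w(1) \<open>0 \<le> Min G\<close> by (simp add: w'_def)
  ultimately show ?case using le by (intro exI[of _ w']) blast
qed

text \<open>Half-open 4-adic intervals. Level and index form one label, so that a cover by cells of
  mixed sizes is a set of labels, with the level read off by \<open>fst\<close>.\<close>

definition cell :: "nat \<times> int \<Rightarrow> real set" where
  "cell = (\<lambda>(m, i). {x. \<lfloor>4 ^ m * x\<rfloor> = i})"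

lemma mem_cell [simp]: "x \<in> cell (m, i) \<longleftrightarrow> \<lfloor>4 ^ m * x\<rfloor> = i"
  by (simp add: cell_def)

text \<open>Nesting of the cells: points that share a fine cell share every coarser one.\<close>

lemma floor_coarsen:
  assumes "m \<le> n"
  shows "\<lfloor>4 ^ m * (x::real)\<rfloor> = \<lfloor>4 ^ n * x\<rfloor> div 4 ^ (n - m)"
proof -
  have "4 ^ m * x = (4 ^ n * x) / real_of_int (4 ^ (n - m))"
    using assms by (simp add: field_simps flip: power_add)
  then show ?thesis by (metis floor_divide_real_eq_div zero_le_numeral zero_le_power)
qed

text \<open>
  With \<open>\<theta> = 4 powr (- a)\<close>, a cell of level \<open>m\<close> has \<open>a\<close>-dimensional size \<open>\<theta> ^ m\<close>, so
  \<open>content_ge\<close> bounds the 4-adic \<open>a\<close>-dimensional content of \<open>K\<close> below by \<open>\<kappa>\<close>.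
\<close>

definition content_ge :: "real \<Rightarrow> real \<Rightarrow> real set \<Rightarrow> bool" where
  "content_ge \<theta> \<kappa> K \<longleftrightarrow>
     (\<forall>F. finite F \<longrightarrow> K \<subseteq> (\<Union>t\<in>F. cell t) \<longrightarrow> \<kappa> \<le> (\<Sum>t\<in>F. \<theta> ^ fst t))"

text \<open>A finitely supported stand-in for a Frostman measure. Growth is controlled only down to
  scale \<open>4 ^ (- n)\<close>, which suffices when a finite cover is tested.\<close>

definition frostman_weight :: "real \<Rightarrow> nat \<Rightarrow> real set \<Rightarrow> (real \<Rightarrow> real) \<Rightarrow> bool" where
  "frostman_weight \<theta> n S w \<longleftrightarrow> finite S \<and> S \<subseteq> {0..1} \<and> (\<forall>x. 0 \<le> w x) \<and>
     (\<forall>m i. m \<le> n \<longrightarrow> (\<Sum>x\<in>S \<inter> cell (m, i). w x) \<le> \<theta> ^ m)"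

text \<open>
  A discrete Frostman lemma. When no weight can be increased any more, every point lies in a
  cell filled to capacity; the maximal such cells are disjoint and cover \<open>K\<close>, so their
  capacities add up to the total weight.
\<close>

lemma ex_frostman_weight:
  assumes "content_ge \<theta> \<kappa> K" and "K \<subseteq> {0..1}" and "0 < \<theta>"
  shows "\<exists>S w. frostman_weight \<theta> n S w \<and> S \<subseteq> K \<and> \<kappa> \<le> (\<Sum>x\<in>S. w x)"
proof -
  define f where "f m x = \<lfloor>4 ^ m * (x::real)\<rfloor>" for m :: nat and x
  have "f n x \<in> {0..4 ^ n}" if "x \<in> K" for x
  proof -
    have "0 \<le> x" "x \<le> 1" using assms(2) that by auto
    then have "0 \<le> 4 ^ n * x" "4 ^ n * x \<le> 4 ^ n * 1"
      by (simp, intro mult_left_mono) auto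
    then have "0 \<le> 4 ^ n * x" "4 ^ n * x < 4 ^ n + 1" by linarith+
    then show ?thesis by (auto simp: f_def floor_le_iff)
  qed
  then have "f n ` K \<subseteq> {0..4 ^ n}" by blast
  then have fin: "finite (f n ` K)" using finite_subset by blast
  \<comment> \<open>Finitely many points of \<open>K\<close> that hit every level-\<open>n\<close>
    cell met by \<open>K\<close>, hence, by nesting, every coarser one.\<close>
  have "\<exists>S\<subseteq>K. finite S \<and> f n ` K = f n ` S"
    using finite_subset_image[OF fin order_refl] by blast
  then obtain S where S: "S \<subseteq> K" "finite S" "f n ` S = f n ` K" by auto
  define T where "T = (SIGMA m:{..n}. f m ` S)"
  have "finite T" using S by (simp add: T_def)
  have "\<exists>w. (\<forall>x. 0 \<le> w x) \<and> (\<forall>t\<in>T. (\<Sum>x\<in>S \<inter> cell t. w x) \<le> \<theta> ^ fst t)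
           \<and> (\<forall>x\<in>S. \<exists>t\<in>T. x \<in> cell t \<and> (\<Sum>y\<in>S \<inter> cell t. w y) = \<theta> ^ fst t)"
    using S(2) \<open>finite T\<close> assms(3) by (intro ex_saturating_weight) (auto simp: T_def f_def)
  then obtain w where w: "\<And>x. 0 \<le> w x" "\<And>t. t \<in> T \<Longrightarrow> (\<Sum>x\<in>S \<inter> cell t. w x) \<le> \<theta> ^ fst t"
    "\<And>x. x \<in> S \<Longrightarrow> \<exists>t\<in>T. x \<in> cell t \<and> (\<Sum>y\<in>S \<inter> cell t. w y) = \<theta> ^ fst t" by blast
  define sat where "sat x m \<longleftrightarrow> m \<le> n \<and> (\<Sum>y\<in>S \<inter> cell (m, f m x). w y) = \<theta> ^ m" for x m
  \<comment> \<open>The level of the coarsest full cell around \<open>x\<close>.\<close>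
  define lv where "lv x = (LEAST m. sat x m)" for x
  have sat: "sat x (lv x)" if "x \<in> S" for x
    using w(3)[OF that] unfolding lv_def
    by (intro LeastI_ex[of "sat x"]) (auto simp: sat_def T_def f_def)
  define g where "g x = (lv x, f (lv x) x)" for x
  have lv_mono: "lv y \<le> lv x" if "x \<in> S" "f (lv x) y = f (lv x) x" for x y
    unfolding lv_def[of y] using sat[OF that(1)] that(2) by (intro Least_le) (auto simp: sat_def)
  \<comment> \<open>The maximal full cell of \<open>x\<close> is a full cell around \<open>y\<close>
    too, so the maximal cell of \<open>y\<close> is at least as large. By nesting it then contains
    \<open>x\<close>, and exchanging the roles gives equality.\<close>
  have lv_eq: "lv y = lv x" if "x \<in> S" "y \<in> S" "f (lv x) y = f (lv x) x" for x y
  proof -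
    have "f (lv y) y = f (lv y) x"
      using that(3) floor_coarsen[OF lv_mono[OF that(1,3)]] by (simp add: f_def)
    then show ?thesis using lv_mono[of x y] lv_mono[of y x] that by auto
  qed
  have fib: "{y \<in> S. g y = g x} = S \<inter> cell (g x)" if "x \<in> S" for x
    using lv_eq[OF that] by (auto simp: g_def f_def)
  have "(\<Sum>x\<in>S. w x) = (\<Sum>t\<in>g ` S. \<Sum>y\<in>{y \<in> S. g y = t}. w y)"
    by (rule sum.image_gen[OF S(2)])
  also have "\<dots> = (\<Sum>t\<in>g ` S. \<theta> ^ fst t)"
  proof (intro sum.cong refl)
    fix t assume "t \<in> g ` S"
    then obtain x where x: "x \<in> S" "t = g x" by blast
    then show "(\<Sum>y\<in>{y \<in> S. g y = t}. w y) = \<theta> ^ fst t"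
      using sat[OF x(1)] unfolding x(2) fib[OF x(1)] by (simp add: g_def sat_def)
  qed
  finally have total: "(\<Sum>x\<in>S. w x) = (\<Sum>t\<in>g ` S. \<theta> ^ fst t)" .
  have "K \<subseteq> (\<Union>t\<in>g ` S. cell t)"
  proof
    fix y assume "y \<in> K"
    then obtain x where x: "x \<in> S" "f n y = f n x" using S(3) by (metis imageE imageI)
    have "f (lv x) y = f (lv x) x"
      using x(2) floor_coarsen[of "lv x" n] sat[OF x(1)] by (simp add: f_def sat_def)
    then show "y \<in> (\<Union>t\<in>g ` S. cell t)" using x by (auto simp: g_def f_def)
  qed
  then have "\<kappa> \<le> (\<Sum>x\<in>S. w x)" using assms(1) S(2) by (simp add: content_ge_def total)
  moreover have "(\<Sum>x\<in>S \<inter> cell (m, i). w x) \<le> \<theta> ^ m" if "m \<le> n" for m i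
  proof (cases "(m, i) \<in> T")
    case True
    then show ?thesis using w(2) by fastforce
  next
    case False
    then have "S \<inter> cell (m, i) = {}" using that by (auto simp: T_def f_def)
    then show ?thesis using assms(3) by simp
  qed
  ultimately show ?thesis
    using S w(1) assms(2) unfolding frostman_weight_def by (intro exI[of _ S] exI[of _ w]) auto
qed

section \<open>Digit sums and the Cantor set\<close>

text \<open>Divided by \<open>4 ^ n\<close>, these are the left endpoints of the
  level-\<open>n\<close> intervals of the Cantor set. New digits are appended on the right, so
  \<open>div 4 ^ l\<close> drops the last \<open>l\<close> digits.\<close>

fun digit_ints :: "nat \<Rightarrow> int set" where
  "digit_ints 0 = {0}"
| "digit_ints (Suc n) = (\<lambda>(p, d). 4 * p + d) ` (digit_ints n \<times> {0, 3})"

lemma digit_ints_SucE: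
  assumes "p \<in> digit_ints (Suc n)"
  obtains p' d where "p' \<in> digit_ints n" "d \<in> {0, 3}" "p = 4 * p' + d"
  using assms by auto

lemma finite_digit_ints [simp]: "finite (digit_ints n)"
  by (induction n) auto

lemma digit_ints_bounds: "p \<in> digit_ints n \<Longrightarrow> 0 \<le> p \<and> p < 4 ^ n"
proof (induction n arbitrary: p)
  case (Suc n)
  then obtain p' d where "p' \<in> digit_ints n" "d \<in> {0, 3}" "p = 4 * p' + d"
    by (elim digit_ints_SucE)
  then show ?case using Suc.IH[of p'] by auto
qed simp

lemma three_dvd_digit_ints: "p \<in> digit_ints n \<Longrightarrow> 3 dvd p"
proof (induction n arbitrary: p)
  case (Suc n)
  then obtain p' d where "p' \<in> digit_ints n" "d \<in> {0, 3}" "p = 4 * p' + d"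
    by (elim digit_ints_SucE)
  then show ?case using Suc.IH[of p'] by auto
qed simp

lemma card_digit_ints: "card (digit_ints n) = 2 ^ n"
proof (induction n)
  case (Suc n)
  have "inj_on (\<lambda>(p, d). 4 * p + d) (digit_ints n \<times> {0, 3::int})"
    by (auto simp: inj_on_def; presburger)
  then show ?case using Suc by (simp add: card_image card_cartesian_product)
qed simp

lemma digit_ints_div: "p \<in> digit_ints (k + l) \<Longrightarrow> p div 4 ^ l \<in> digit_ints k"
proof (induction l arbitrary: p)
  case (Suc l)
  then obtain p' d where "p' \<in> digit_ints (k + l)" "d \<in> {0, 3}" "p = 4 * p' + d"
    using Suc.prems by (auto elim!: digit_ints_SucE)
  moreover from this have "p div 4 ^ Suc l = p' div 4 ^ l"
    by (auto simp: zdiv_zmult2_eq)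
  ultimately show ?case using Suc.IH by metis
qed simp

lemma card_digit_ints_fibre: "card {p \<in> digit_ints (k + l). p div 4 ^ l = P} \<le> 2 ^ l"
proof (induction l)
  case 0
  have "{p \<in> digit_ints k. p = P} \<subseteq> {P}" by auto
  then show ?case using card_mono[of "{P}"] by fastforce
next
  case (Suc l)
  define T where "T = {p \<in> digit_ints (k + l). p div 4 ^ l = P}"
  have "{p \<in> digit_ints (k + Suc l). p div 4 ^ Suc l = P} \<subseteq> (\<lambda>(p, d). 4 * p + d) ` (T \<times> {0, 3})"
    by (auto simp: T_def zdiv_zmult2_eq)
  moreover have "finite T" by (simp add: T_def)
  ultimately have "card {p \<in> digit_ints (k + Suc l). p div 4 ^ Suc l = P} \<le> card (T \<times> {0, 3::int})"
    by (intro surj_card_le) auto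
  also have "\<dots> \<le> 2 ^ Suc l" using Suc by (simp add: T_def card_cartesian_product)
  finally show ?case .
qed

text \<open>Truncations are multiples of 3, so distinct ones differ by at least 3; the dropped
  digits make up for less than one unit \<open>4 ^ l\<close>, which leaves a distance greater than
  \<open>2 * 4 ^ l\<close>.\<close>

lemma digit_ints_separated:
  assumes "p \<in> digit_ints (k + l)" "q \<in> digit_ints (k + l)" "\<bar>p - q\<bar> \<le> 2 * 4 ^ l"
  shows "p div 4 ^ l = q div 4 ^ l"
proof (rule ccontr)
  define z :: int where "z = 4 ^ l"
  define P Q where "P = p div z" and "Q = q div z"
  assume "p div 4 ^ l \<noteq> q div 4 ^ l"
  then have "P \<noteq> Q" by (simp add: P_def Q_def z_def)
  moreover have "3 dvd P" "3 dvd Q"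
    unfolding P_def Q_def z_def by (intro three_dvd_digit_ints[of _ k] digit_ints_div assms)+
  ultimately have "P - Q \<ge> 3 \<or> Q - P \<ge> 3" by presburger
  moreover have z: "0 < z" by (simp add: z_def)
  moreover have "z * 3 \<le> z * (P - Q)" if "P - Q \<ge> 3" using z that by (intro mult_left_mono) auto
  moreover have "z * 3 \<le> z * (Q - P)" if "Q - P \<ge> 3" using z that by (intro mult_left_mono) auto
  moreover have "p = z * P + p mod z" "q = z * Q + q mod z" by (simp_all add: P_def Q_def)
  moreover have "0 \<le> p mod z" "p mod z < z" "0 \<le> q mod z" "q mod z < z" using z by simp_all
  ultimately show False using assms(3) unfolding z_def[symmetric] right_diff_distrib by linarith
qed

text \<open>By separation, a partner of \<open>p\<close> shares the first \<open>j\<close> digits of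
  \<open>p\<close>, which leaves at most \<open>2 ^ (n - j)\<close> choices. This expresses that the
  Cantor set has dimension 1/2.\<close>

lemma card_close_pairs:
  assumes "j \<le> n"
  shows "card {(p, p'). p \<in> digit_ints n \<and> p' \<in> digit_ints n \<and> \<bar>p - p'\<bar> \<le> 2 * 4 ^ (n - j)}
         \<le> 2 ^ n * 2 ^ (n - j)" (is "card ?L \<le> _")
proof -
  obtain l where n: "n = j + l" using assms le_Suc_ex by blast
  then have l: "n - j = l" by simp
  define F where "F p = {p' \<in> digit_ints n. p' div 4 ^ l = p div 4 ^ l}" for p
  have "?L \<subseteq> Sigma (digit_ints n) F"
  proof
    fix t assume "t \<in> ?L"
    then obtain p p' where "t = (p, p')" "p \<in> digit_ints n" "p' \<in> digit_ints n"
      "\<bar>p - p'\<bar> \<le> 2 * 4 ^ l" unfolding l by blast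
    then show "t \<in> Sigma (digit_ints n) F"
      using digit_ints_separated[of p j l p'] by (simp add: F_def n)
  qed
  then have "card ?L \<le> card (Sigma (digit_ints n) F)"
    by (intro card_mono) (auto simp: F_def)
  also have "\<dots> = (\<Sum>p\<in>digit_ints n. card (F p))" by (simp add: F_def)
  also have "\<dots> \<le> (\<Sum>p\<in>digit_ints n. 2 ^ l)"
    unfolding F_def n by (intro sum_mono card_digit_ints_fibre)
  finally show ?thesis by (simp add: card_digit_ints l)
qed

text \<open>Induction on the last digit: 6 of the 16 digit quadruples satisfy the equation, and no
  carry links a digit to the earlier ones.\<close>

lemma additive_energy_digit_ints:
  "card {(p, p', q, q'). p \<in> digit_ints k \<and> p' \<in> digit_ints k \<and> q \<in> digit_ints k
           \<and> q' \<in> digit_ints k \<and> p - p' = q - q'} \<le> 6 ^ k" (is "card (?E k) \<le> _")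
proof (induction k)
  case (Suc k)
  define D :: "(int \<times> int \<times> int \<times> int) set"
    where "D = {(0,0,0,0), (3,3,3,3), (0,0,3,3), (3,3,0,0), (3,0,3,0), (0,3,0,3)}"
  define f :: "(int \<times> int \<times> int \<times> int) \<times> (int \<times> int \<times> int \<times> int) \<Rightarrow> int \<times> int \<times> int \<times> int"
    where "f = (\<lambda>((p, p', q, q'), (a, a', b, b')). (4 * p + a, 4 * p' + a', 4 * q + b, 4 * q' + b'))"
  have fin: "finite (?E k)"
    by (rule finite_subset[of _ "digit_ints k \<times> digit_ints k \<times> digit_ints k \<times> digit_ints k"]) auto
  have "?E (Suc k) \<subseteq> f ` (?E k \<times> D)"
  proof
    fix t assume "t \<in> ?E (Suc k)"
    then obtain u u' v v' where t: "t = (u, u', v, v')"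
      and mem: "u \<in> digit_ints (Suc k)" "u' \<in> digit_ints (Suc k)"
        "v \<in> digit_ints (Suc k)" "v' \<in> digit_ints (Suc k)" and eq: "u - u' = v - v'"
      by (auto simp del: digit_ints.simps)
    obtain p a where p: "p \<in> digit_ints k" "a \<in> {0, 3}" "u = 4 * p + a"
      using mem(1) by (rule digit_ints_SucE)
    obtain p' a' where p': "p' \<in> digit_ints k" "a' \<in> {0, 3}" "u' = 4 * p' + a'"
      using mem(2) by (rule digit_ints_SucE)
    obtain q b where q: "q \<in> digit_ints k" "b \<in> {0, 3}" "v = 4 * q + b"
      using mem(3) by (rule digit_ints_SucE)
    obtain q' b' where q': "q' \<in> digit_ints k" "b' \<in> {0, 3}" "v' = 4 * q' + b'"
      using mem(4) by (rule digit_ints_SucE)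
    note dig = p(2) p'(2) q(2) q'(2)
    note eq = eq[unfolded p(3) p'(3) q(3) q'(3)]
    \<comment> \<open>The equation makes this combination of last digits divisible by 4, and 0 is
      the only such value among the possible ones.\<close>
    define e where "e = a - a' - b + b'"
    have "e \<in> {-6, -3, 0, 3, 6}" using dig by (auto simp: e_def)
    moreover have "e = 4 * (q - q' - p + p')" using eq by (simp add: e_def)
    ultimately have "e = 0" by (elim insertE emptyE; presburger)
    then have "p - p' = q - q'" using eq by (simp add: e_def)
    moreover have "(a, a', b, b') \<in> D" using dig \<open>e = 0\<close> by (auto simp: D_def e_def)
    ultimately have "((p, p', q, q'), (a, a', b, b')) \<in> ?E k \<times> D"
      using p(1) p'(1) q(1) q'(1) by simp
    then show "t \<in> f ` (?E k \<times> D)" by (rule rev_image_eqI) (simp add: f_def t p q p' q')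
  qed
  then have "card (?E (Suc k)) \<le> card (?E k \<times> D)"
    using fin by (intro surj_card_le) (auto simp: D_def)
  also have "\<dots> = card (?E k) * 6" by (simp add: card_cartesian_product D_def)
  also have "\<dots> \<le> 6 ^ k * 6" by (rule mult_le_mono1[OF Suc])
  finally show ?case by (simp add: mult.commute)
next
  case 0
  have "?E 0 \<subseteq> {(0, 0, 0, 0)}" by auto
  from card_mono[OF _ this] show ?case by simp
qed

section \<open>Digit sums as points of the Cantor set, and its compactness\<close>

lemma digit_ints_cantor_set:
  assumes "p \<in> digit_ints n"
  shows "real_of_int p / 4 ^ n \<in> cantor_set"
proof -
  have "\<exists>\<epsilon>. (\<forall>j. \<epsilon> j \<in> {0, 3}) \<and> (\<forall>j\<ge>n. \<epsilon> j = 0) \<and>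
          (\<Sum>j<n. \<epsilon> j / 4 ^ Suc j) = real_of_int p / 4 ^ n"
    using assms
  proof (induction n arbitrary: p)
    case 0
    then show ?case by (intro exI[of _ "\<lambda>_. 0"]) auto
  next
    case (Suc n)
    then obtain p' d where p': "p' \<in> digit_ints n" "d \<in> {0, 3}" "p = 4 * p' + d" by auto
    with Suc.IH obtain \<epsilon> where \<epsilon>: "\<And>j. \<epsilon> j \<in> {0, 3}" "\<And>j. j \<ge> n \<Longrightarrow> \<epsilon> j = 0"
      "(\<Sum>j<n. \<epsilon> j / 4 ^ Suc j) = real_of_int p' / 4 ^ n" by blast
    have "(\<Sum>j<n. (\<epsilon>(n := real_of_int d)) j / 4 ^ Suc j) = (\<Sum>j<n. \<epsilon> j / 4 ^ Suc j)"
      by (intro sum.cong) auto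
    then have "(\<Sum>j<Suc n. (\<epsilon>(n := real_of_int d)) j / 4 ^ Suc j) = real_of_int p / 4 ^ Suc n"
      using \<epsilon>(3) p'(3) by (simp add: field_simps)
    moreover have "\<forall>j. (\<epsilon>(n := real_of_int d)) j \<in> {0, 3}" using \<epsilon>(1) p'(2) by auto
    moreover have "\<forall>j\<ge>Suc n. (\<epsilon>(n := real_of_int d)) j = 0" using \<epsilon>(2) by auto
    ultimately show ?case by blast
  qed
  then obtain \<epsilon> where \<epsilon>: "\<And>j. \<epsilon> j \<in> {0, 3}" "\<And>j. j \<ge> n \<Longrightarrow> \<epsilon> j = 0"
    "(\<Sum>j<n. \<epsilon> j / 4 ^ Suc j) = real_of_int p / 4 ^ n" by blast
  have "(\<Sum>j. \<epsilon> j / 4 ^ Suc j) = (\<Sum>j<n. \<epsilon> j / 4 ^ Suc j)"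
    using \<epsilon>(2) by (intro suminf_finite) auto
  then have "real_of_int p / 4 ^ n = (\<Sum>j. \<epsilon> j / 4 ^ Suc j)" using \<epsilon>(3) by simp
  then show ?thesis using \<epsilon>(1) unfolding cantor_set_def by blast
qed

text \<open>The digit sequences form a compact product space by Tychonoff's theorem, and the digit
  series is continuous on it, being uniformly convergent by comparison with a geometric
  series.\<close>

lemma compact_cantor_set: "compact cantor_set"
proof -
  define X where "X = (\<Pi>\<^sub>E j\<in>(UNIV::nat set). {0, 3::real})"
  have "compactin (product_topology (\<lambda>_. euclidean) UNIV) X"
    unfolding X_def by (simp add: compactin_PiE)
  then have "compact X" by (simp add: euclidean_product_topology)
  moreover have "continuous_on X (\<lambda>\<epsilon>. \<Sum>j. \<epsilon> j / 4 ^ Suc j)"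
  proof (rule uniform_limit_theorem[OF always_eventually])
    show "\<forall>n. continuous_on X (\<lambda>\<epsilon>. \<Sum>j<n. \<epsilon> j / 4 ^ Suc j)"
      by (intro allI continuous_intros continuous_on_subset[OF continuous_on_product_coordinates]) auto
    have "\<epsilon> j \<in> {0, 3}" if "\<epsilon> \<in> X" for \<epsilon> j using that by (auto simp: X_def PiE_iff)
    then have "norm (\<epsilon> j / 4 ^ Suc j) \<le> 3 / 4 * (1 / 4 :: real) ^ j" if "\<epsilon> \<in> X" for \<epsilon> j
    proof -
      have "\<epsilon> j = 0 \<or> \<epsilon> j = 3" using \<open>\<And>j \<epsilon>. \<epsilon> \<in> X \<Longrightarrow> \<epsilon> j \<in> {0, 3}\<close>[OF that] by simp
      then show ?thesis by (elim disjE) (simp_all add: field_simps power_one_over)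
    qed
    then show "uniform_limit X (\<lambda>n \<epsilon>. \<Sum>j<n. \<epsilon> j / 4 ^ Suc j) (\<lambda>\<epsilon>. \<Sum>j. \<epsilon> j / 4 ^ Suc j) sequentially"
      by (rule Weierstrass_m_test) (assumption, intro summable_mult summable_geometric, simp)
  qed simp
  ultimately have "compact ((\<lambda>\<epsilon>. \<Sum>j. \<epsilon> j / 4 ^ Suc j) ` X)" by (rule compact_continuous_image[rotated])
  moreover have "(\<lambda>\<epsilon>. \<Sum>j. \<epsilon> j / 4 ^ Suc j) ` X = cantor_set"
    unfolding cantor_set_def X_def by (simp add: PiE_UNIV_domain Pi_def setcompr_eq_image)
  ultimately show ?thesis by simp
qed

section \<open>Collisions over interior points: additive energy\<close>

lemma card_spread_le:
  fixes I :: "int set"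
  assumes "finite I" "0 \<le> L" "\<And>a b. a \<in> I \<Longrightarrow> b \<in> I \<Longrightarrow> \<bar>real_of_int a - real_of_int b\<bar> \<le> L"
  shows "real (card I) \<le> L + 1"
proof (cases "I = {}")
  case False
  have "I \<subseteq> {Min I..Max I}" using assms(1) by auto
  then have "card I \<le> card {Min I..Max I}" by (intro card_mono) auto
  moreover have "Min I \<le> Max I" using False assms(1) by simp
  ultimately have "real (card I) \<le> real_of_int (Max I) - real_of_int (Min I) + 1" by simp
  also have "\<dots> \<le> L + 1" using assms(3)[of "Max I" "Min I"] False assms(1) by simp
  finally show ?thesis .
qed (use assms(2) in simp)

lemma card_le_card_times_fibre:
  assumes "finite B" "f ` A \<subseteq> B" "\<And>b. b \<in> B \<Longrightarrow> card {a \<in> A. f a = b} \<le> m" "finite A"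
  shows "card A \<le> card B * m"
proof -
  have "card A = (\<Sum>b\<in>f ` A. card {a \<in> A. f a = b})"
    using sum.image_gen[OF assms(4), of "\<lambda>_. 1 :: nat" f] by simp
  also have "\<dots> \<le> (\<Sum>b\<in>f ` A. m)" using assms(2,3) by (intro sum_mono) auto
  also have "\<dots> \<le> card B * m" using card_mono[OF assms(1,2)] by simp
  finally show ?thesis .
qed

lemma real_card_eq_sum_of_bool:
  "finite A \<Longrightarrow> real (card {a \<in> A. P a}) = (\<Sum>a\<in>A. of_bool (P a))"
  by (simp add: Int_def)

text \<open>Schur's test for the relation \<open>R\<close> on the values of \<open>\<delta>\<close>.\<close>

lemma card_related_pairs_le_energy:
  fixes \<delta> :: "'a \<Rightarrow> 'b"
  assumes "finite D"
    and row: "\<And>U. U \<in> \<delta> ` D \<Longrightarrow> real (card {V \<in> \<delta> ` D. R U V}) \<le> M"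
    and col: "\<And>V. V \<in> \<delta> ` D \<Longrightarrow> real (card {U \<in> \<delta> ` D. R U V}) \<le> M"
  shows "real (card {(d, e). d \<in> D \<and> e \<in> D \<and> R (\<delta> d) (\<delta> e)})
         \<le> M * real (card {(d, e). d \<in> D \<and> e \<in> D \<and> \<delta> d = \<delta> e})"
proof -
  define I where "I = \<delta> ` D"
  define r where "r U = real (card {d \<in> D. \<delta> d = U})" for U
  have fin: "finite I" using assms(1) by (simp add: I_def)
  have grp: "(\<Sum>d\<in>D. h (\<delta> d)) = (\<Sum>U\<in>I. r U * h U)" for h :: "'b \<Rightarrow> real"
  proof -
    have "(\<Sum>d\<in>D. h (\<delta> d)) = (\<Sum>U\<in>I. \<Sum>d\<in>{d \<in> D. \<delta> d = U}. h (\<delta> d))"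
      unfolding I_def by (rule sum.image_gen[OF assms(1)])
    also have "\<dots> = (\<Sum>U\<in>I. \<Sum>d\<in>{d \<in> D. \<delta> d = U}. h U)" by (intro sum.cong) auto
    finally show ?thesis by (simp add: r_def)
  qed
  have pairs: "real (card {(d, e). d \<in> D \<and> e \<in> D \<and> Q (\<delta> d) (\<delta> e)})
      = (\<Sum>U\<in>I. \<Sum>V\<in>I. r U * r V * of_bool (Q U V))" for Q
  proof -
    have "{(d, e). d \<in> D \<and> e \<in> D \<and> Q (\<delta> d) (\<delta> e)} = (SIGMA d:D. {e \<in> D. Q (\<delta> d) (\<delta> e)})"
      by auto
    then have "real (card {(d, e). d \<in> D \<and> e \<in> D \<and> Q (\<delta> d) (\<delta> e)})
        = (\<Sum>d\<in>D. real (card {e \<in> D. Q (\<delta> d) (\<delta> e)}))" using assms(1) by simp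
    also have "\<dots> = (\<Sum>d\<in>D. \<Sum>e\<in>D. of_bool (Q (\<delta> d) (\<delta> e)))"
      using assms(1) by (simp only: real_card_eq_sum_of_bool)
    also have "\<dots> = (\<Sum>U\<in>I. r U * (\<Sum>V\<in>I. r V * of_bool (Q U V)))"
      by (simp only: grp[of "\<lambda>V. of_bool (Q U V)" for U] grp[of "\<lambda>U. \<Sum>V\<in>I. r V * of_bool (Q U V)"])
    finally show ?thesis by (simp add: sum_distrib_left mult.assoc)
  qed
  \<comment> \<open>The inequality of arithmetic and geometric means splits the form into a sum
    along rows and a sum along columns, where \<open>R\<close> has at most \<open>M\<close> entries
    each.\<close>
  have "(\<Sum>U\<in>I. \<Sum>V\<in>I. r U * r V * of_bool (R U V))
      \<le> (\<Sum>U\<in>I. \<Sum>V\<in>I. ((r U)\<^sup>2 / 2 + (r V)\<^sup>2 / 2) * of_bool (R U V))"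
  proof (intro sum_mono mult_right_mono)
    fix U V show "r U * r V \<le> (r U)\<^sup>2 / 2 + (r V)\<^sup>2 / 2"
      using sum_squares_bound[of "r U" "r V"] by simp
  qed simp
  also have "\<dots> = (\<Sum>U\<in>I. \<Sum>V\<in>I. (r U)\<^sup>2 / 2 * of_bool (R U V))
      + (\<Sum>V\<in>I. \<Sum>U\<in>I. (r V)\<^sup>2 / 2 * of_bool (R U V))"
    by (subst (2) sum.swap) (simp add: sum.distrib distrib_right)
  also have "\<dots> = (\<Sum>U\<in>I. (r U)\<^sup>2 / 2 * real (card {V \<in> I. R U V}))
      + (\<Sum>V\<in>I. (r V)\<^sup>2 / 2 * real (card {U \<in> I. R U V}))"
    by (simp only: sum_distrib_left[symmetric] real_card_eq_sum_of_bool[OF fin])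
  also have "\<dots> \<le> (\<Sum>U\<in>I. (r U)\<^sup>2 / 2 * M) + (\<Sum>V\<in>I. (r V)\<^sup>2 / 2 * M)"
    using row col by (intro add_mono sum_mono mult_left_mono) (auto simp: I_def)
  also have "\<dots> = M * (\<Sum>U\<in>I. (r U)\<^sup>2)"
    by (simp add: sum_distrib_left sum.distrib[symmetric] mult.commute)
  \<comment> \<open>Squared multiplicities count pairs with equal values: the right-hand side is the
    one of \<open>pairs\<close> for the relation of equality.\<close>
  also have "(\<Sum>U\<in>I. (r U)\<^sup>2) = (\<Sum>U\<in>I. \<Sum>V\<in>I. r U * r V * of_bool (U = V))"
  proof (intro sum.cong refl)
    fix U assume "U \<in> I"
    have "(\<Sum>V\<in>I. r U * r V * of_bool (U = V)) = (\<Sum>V\<in>I. if V = U then (r U)\<^sup>2 else 0)"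
      by (intro sum.cong) (auto simp: power2_eq_square)
    then show "(r U)\<^sup>2 = (\<Sum>V\<in>I. r U * r V * of_bool (U = V))"
      using \<open>U \<in> I\<close> fin by simp
  qed
  finally show ?thesis unfolding pairs .
qed

text \<open>Serves in two roles: two values \<open>(p, p')\<close> of one parameter, as in
  \<open>quads\<close>, and the two parameters \<open>(p, q)\<close> of one point, as in
  \<open>seg_point\<close>.\<close>

definition digit_pairs :: "nat \<Rightarrow> (int \<times> int) set" where
  "digit_pairs n = digit_ints n \<times> digit_ints n"

definition diff :: "int \<times> int \<Rightarrow> int" where
  "diff d = fst d - snd d"

text \<open>
  Writing \<open>d = (p, p')\<close> and \<open>e = (q, q')\<close>, the quadruples whose points over \<open>x\<close> with parameters
  \<open>(p, q) / 4 ^ n\<close> and \<open>(p', q') / 4 ^ n\<close> are at distance at most \<open>2 * 4 ^ (- k)\<close>.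
\<close>

definition quads :: "nat \<Rightarrow> nat \<Rightarrow> real \<Rightarrow> ((int \<times> int) \<times> (int \<times> int)) set" where
  "quads n k x = {(d, e). d \<in> digit_pairs n \<and> e \<in> digit_pairs n \<and>
     \<bar>(1 - x) * diff d + x * diff e / 2\<bar> \<le> 2 * 4 ^ (n - k)}"

lemma finite_digit_pairs [simp]: "finite (digit_pairs n)"
  by (simp add: digit_pairs_def)

lemma quads_subset: "quads n k x \<subseteq> digit_pairs n \<times> digit_pairs n"
  by (auto simp: quads_def)

lemma finite_quads [simp]: "finite (quads n k x)"
  by (rule finite_subset[OF quads_subset]) simp

text \<open>Both coefficients stay away from 0, so fixing one difference confines the other to a
  bounded interval. Schur's test then reduces the count to pairs with equal differences, the
  additive energy.\<close>

lemma card_coarse_quads: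
  fixes x \<eta> :: real
  assumes "0 < \<eta>" "\<eta> \<le> x" "x \<le> 1 - \<eta>"
  shows "real (card {(d, e). d \<in> digit_pairs k \<and> e \<in> digit_pairs k \<and>
           \<bar>(1 - x) * diff d + x * diff e / 2\<bar> \<le> 3}) \<le> (12 / \<eta> + 1) * 6 ^ k"
proof -
  define R where "R U V \<longleftrightarrow> \<bar>(1 - x) * real_of_int U + x * real_of_int V / 2\<bar> \<le> 3" for U V :: int
  \<comment> \<open>The constant 12 comes from the rows: two values of size at most 3 differ by at
    most 6, and the coefficient there is \<open>x / 2\<close>.\<close>
  have gap: "\<bar>s - t\<bar> \<le> 12 / \<eta>" if "\<eta> * \<bar>s - t\<bar> \<le> 12" for s t :: real
    using that assms(1) by (simp add: field_simps)
  have row: "real (card {V \<in> diff ` digit_pairs k. R U V}) \<le> 12 / \<eta> + 1" for U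
  proof (rule card_spread_le)
    fix V V' assume "V \<in> {V \<in> diff ` digit_pairs k. R U V}" "V' \<in> {V \<in> diff ` digit_pairs k. R U V}"
    then have "\<bar>x / 2 * (real_of_int V - real_of_int V')\<bar> \<le> 6"
      unfolding R_def mem_Collect_eq right_diff_distrib by (auto simp: abs_le_iff)
    then have "x * \<bar>real_of_int V - real_of_int V'\<bar> \<le> 12"
      using assms by (simp add: abs_mult)
    moreover have "\<eta> * \<bar>real_of_int V - real_of_int V'\<bar> \<le> x * \<bar>real_of_int V - real_of_int V'\<bar>"
      using assms by (intro mult_right_mono) auto
    ultimately show "\<bar>real_of_int V - real_of_int V'\<bar> \<le> 12 / \<eta>" by (intro gap) linarith
  qed (use assms(1) in auto)
  have col: "real (card {U \<in> diff ` digit_pairs k. R U V}) \<le> 12 / \<eta> + 1" for V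
  proof (rule card_spread_le)
    fix U U' assume "U \<in> {U \<in> diff ` digit_pairs k. R U V}" "U' \<in> {U \<in> diff ` digit_pairs k. R U V}"
    then have "\<bar>(1 - x) * (real_of_int U - real_of_int U')\<bar> \<le> 6"
      unfolding R_def mem_Collect_eq right_diff_distrib by (auto simp: abs_le_iff)
    then have "(1 - x) * \<bar>real_of_int U - real_of_int U'\<bar> \<le> 12"
      using assms by (simp add: abs_mult)
    moreover have "\<eta> * \<bar>real_of_int U - real_of_int U'\<bar> \<le> (1 - x) * \<bar>real_of_int U - real_of_int U'\<bar>"
      using assms by (intro mult_right_mono) auto
    ultimately show "\<bar>real_of_int U - real_of_int U'\<bar> \<le> 12 / \<eta>" by (intro gap) linarith
  qed (use assms(1) in auto)
  have "real (card {(d, e). d \<in> digit_pairs k \<and> e \<in> digit_pairs k \<and> R (diff d) (diff e)})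
      \<le> (12 / \<eta> + 1) * real (card {(d, e). d \<in> digit_pairs k \<and> e \<in> digit_pairs k \<and> diff d = diff e})"
    by (rule card_related_pairs_le_energy) (use row col in auto)
  also have "card {(d, e). d \<in> digit_pairs k \<and> e \<in> digit_pairs k \<and> diff d = diff e} \<le> 6 ^ k"
  proof -
    let ?E = "{(p, p', q, q'). p \<in> digit_ints k \<and> p' \<in> digit_ints k \<and> q \<in> digit_ints k
           \<and> q' \<in> digit_ints k \<and> p - p' = q - q'}"
    have "finite ?E"
      by (rule finite_subset[of _ "digit_ints k \<times> digit_ints k \<times> digit_ints k \<times> digit_ints k"]) auto
    moreover have "{(d, e). d \<in> digit_pairs k \<and> e \<in> digit_pairs k \<and> diff d = diff e}
        \<subseteq> (\<lambda>(p, p', q, q'). ((p, p'), (q, q'))) ` ?E"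
      by (force simp: digit_pairs_def diff_def)
    ultimately show ?thesis
      using surj_card_le additive_energy_digit_ints[of k] by (meson order.trans)
  qed
  then have "(12 / \<eta> + 1) * real (card {(d, e). d \<in> digit_pairs k \<and> e \<in> digit_pairs k \<and> diff d = diff e})
      \<le> (12 / \<eta> + 1) * 6 ^ k"
    using assms(1) by (intro mult_left_mono) (auto simp flip: of_nat_power_le_of_nat_cancel_iff)
  finally show ?thesis by (simp add: R_def)
qed

text \<open>Only the first \<open>k\<close> digits are kept. With \<open>l = n - k\<close>,
  truncation moves each difference by at most \<open>4 ^ l\<close>, so the bound 2 becomes 3 in
  coarse units. Each coarse quadruple has at most \<open>16 ^ l\<close> extensions, and
  \<open>6 ^ k * 16 ^ l = 16 ^ n * (3 / 8) ^ k\<close>.\<close>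

lemma card_quads_interior:
  fixes x \<eta> :: real
  assumes "0 < \<eta>" "\<eta> \<le> x" "x \<le> 1 - \<eta>" "k \<le> n"
  shows "real (card (quads n k x)) \<le> (12 / \<eta> + 1) * 16 ^ n * (3 / 8) ^ k"
proof -
  obtain l where n: "n = k + l" using assms(4) le_Suc_ex by blast
  define z :: int where "z = 4 ^ l"
  have z: "0 < z" by (simp add: z_def)
  define f where "f = (\<lambda>((p, p'), (q, q')). ((p div z, p' div z), (q div z, q' div z)))"
  define B where "B = {(d, e). d \<in> digit_pairs k \<and> e \<in> digit_pairs k \<and>
           \<bar>(1 - x) * diff d + x * diff e / 2\<bar> \<le> 3}"
  define fib where "fib P = {p \<in> digit_ints n. p div z = P}" for P
  have finB: "finite B"
    by (rule finite_subset[of _ "digit_pairs k \<times> digit_pairs k"]) (auto simp: B_def)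
  have fib: "finite (fib P)" "card (fib P) \<le> 2 ^ l" for P
    using card_digit_ints_fibre[of k l P] by (simp_all add: fib_def n z_def)
  have round: "\<bar>z * (real_of_int (p div z) - real_of_int (p' div z)) - (real_of_int p - real_of_int p')\<bar> \<le> z" for p p'
  proof -
    have "p = z * (p div z) + p mod z" "p' = z * (p' div z) + p' mod z" by simp_all
    then have "real_of_int p = z * real_of_int (p div z) + real_of_int (p mod z)"
      "real_of_int p' = z * real_of_int (p' div z) + real_of_int (p' mod z)"
      by (metis of_int_add of_int_mult)+
    moreover have "0 \<le> p mod z" "p mod z \<le> z" "0 \<le> p' mod z" "p' mod z \<le> z"
      using z by (simp_all add: less_imp_le)
    then have "0 \<le> real_of_int (p mod z)" "real_of_int (p mod z) \<le> z"
      "0 \<le> real_of_int (p' mod z)" "real_of_int (p' mod z) \<le> z" by simp_all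
    ultimately show ?thesis unfolding right_diff_distrib by linarith
  qed
  have "f ` quads n k x \<subseteq> B"
  proof
    fix t assume "t \<in> f ` quads n k x"
    then obtain p p' q q' where t: "t = f ((p, p'), (q, q'))"
      and mem: "p \<in> digit_ints n" "p' \<in> digit_ints n" "q \<in> digit_ints n" "q' \<in> digit_ints n"
      and le: "\<bar>(1 - x) * (real_of_int p - real_of_int p') + x * (real_of_int q - real_of_int q') / 2\<bar> \<le> 2 * z"
      by (auto simp: quads_def digit_pairs_def diff_def n z_def)
    define U V u v where "U = real_of_int (p div z) - real_of_int (p' div z)"
      and "V = real_of_int (q div z) - real_of_int (q' div z)"
      and "u = real_of_int p - real_of_int p'" and "v = real_of_int q - real_of_int q'"
    have "\<bar>(1 - x) * (z * U - u)\<bar> \<le> (1 - x) * z"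
      unfolding abs_mult U_def u_def using round[of p p'] assms by (simp add: mult_left_mono)
    moreover have "\<bar>x * (z * V - v)\<bar> \<le> x * z"
      unfolding abs_mult V_def v_def using round[of q q'] assms by (simp add: mult_left_mono)
    moreover have "\<bar>(1 - x) * u + x * v / 2\<bar> \<le> 2 * z" using le by (simp add: u_def v_def)
    moreover have "z * ((1 - x) * U + x * V / 2)
        = ((1 - x) * u + x * v / 2) + (1 - x) * (z * U - u) + x * (z * V - v) / 2"
      by (simp add: field_simps)
    moreover have "x * z \<ge> 0" using assms z by simp
    moreover have "(1 - x) * z = z - x * z" by (simp add: algebra_simps)
    ultimately have "\<bar>z * ((1 - x) * U + x * V / 2)\<bar> \<le> z * 3" by linarith
    then have "\<bar>(1 - x) * U + x * V / 2\<bar> \<le> 3"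
      using z by (simp only: abs_mult) simp
    moreover have "p div z \<in> digit_ints k" "p' div z \<in> digit_ints k"
      "q div z \<in> digit_ints k" "q' div z \<in> digit_ints k"
      using mem by (auto simp: z_def n intro: digit_ints_div)
    ultimately show "t \<in> B" by (simp add: t f_def B_def digit_pairs_def diff_def U_def V_def)
  qed
  moreover have "card {t \<in> quads n k x. f t = b} \<le> 16 ^ l" for b
  proof -
    obtain P P' Q Q' where b: "b = ((P, P'), (Q, Q'))" by (metis surj_pair)
    have "{t \<in> quads n k x. f t = b} \<subseteq> (fib P \<times> fib P') \<times> (fib Q \<times> fib Q')"
      by (auto simp: quads_def digit_pairs_def f_def b fib_def)
    then have "card {t \<in> quads n k x. f t = b} \<le> card ((fib P \<times> fib P') \<times> (fib Q \<times> fib Q'))"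
      using fib(1) by (intro card_mono) auto
    also have "\<dots> \<le> (2 ^ l * 2 ^ l) * (2 ^ l * 2 ^ l)"
      unfolding card_cartesian_product by (intro mult_le_mono fib(2))
    also have "\<dots> = 16 ^ l" by (simp flip: power_mult_distrib)
    finally show ?thesis .
  qed
  ultimately have "card (quads n k x) \<le> card B * 16 ^ l"
    by (intro card_le_card_times_fibre[where f = f] finB) auto
  then have "real (card (quads n k x)) \<le> real (card B) * 16 ^ l"
    by (metis of_nat_le_iff of_nat_mult of_nat_numeral of_nat_power)
  also have "\<dots> \<le> (12 / \<eta> + 1) * 6 ^ k * 16 ^ l"
    using card_coarse_quads[OF assms(1-3), of k] unfolding B_def by (intro mult_right_mono) auto
  also have "(6::real) ^ k = 16 ^ k * (3 / 8) ^ k" by (simp flip: power_mult_distrib)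
  finally show ?thesis by (simp add: n power_add mult_ac)
qed

section \<open>Collisions on average: Kaufman's argument\<close>

text \<open>Transversality for the affine function with end values \<open>u\<close> and
  \<open>v\<close>. If its slope has size at least \<open>m / 2\<close>, points where it is small
  are close together; otherwise it stays within \<open>m / 2\<close> of both end values, which
  forces \<open>m / 2 \<le> \<rho>\<close>, and \<open>\<bar>x - y\<bar> \<le> 1\<close>
  suffices.\<close>

lemma affine_small_set:
  fixes u v x y \<rho> m :: real
  assumes xy: "x \<in> {0..1}" "y \<in> {0..1}" and "m \<le> \<bar>u\<bar> \<or> m \<le> \<bar>v\<bar>"
    and fx: "\<bar>(1 - x) * u + x * v\<bar> \<le> \<rho>" and fy: "\<bar>(1 - y) * u + y * v\<bar> \<le> \<rho>"
  shows "m * \<bar>x - y\<bar> \<le> 4 * \<rho>"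
proof (cases "m / 2 \<le> \<bar>v - u\<bar>")
  case True
  have "((1 - x) * u + x * v) - ((1 - y) * u + y * v) = (v - u) * (x - y)" by (simp add: algebra_simps)
  then have "\<bar>v - u\<bar> * \<bar>x - y\<bar> \<le> 2 * \<rho>" using fx fy by (simp flip: abs_mult)
  moreover have "m / 2 * \<bar>x - y\<bar> \<le> \<bar>v - u\<bar> * \<bar>x - y\<bar>" using True by (intro mult_right_mono) auto
  ultimately show ?thesis by linarith
next
  case False
  have e: "(1 - x) * u + x * v = u + x * (v - u)" "(1 - x) * u + x * v = v - (1 - x) * (v - u)"
    by (simp_all add: algebra_simps)
  have "\<bar>x * (v - u)\<bar> \<le> \<bar>v - u\<bar>" "\<bar>(1 - x) * (v - u)\<bar> \<le> \<bar>v - u\<bar>"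
    using xy(1) by (auto simp: abs_mult intro!: mult_left_le_one_le)
  then have "m / 2 \<le> \<rho>" using assms(3) fx e False by linarith
  moreover have "0 \<le> m" using False abs_ge_zero[of "v - u"] by linarith
  then have "m * \<bar>x - y\<bar> \<le> m * 1" using xy by (intro mult_left_mono) auto
  ultimately show ?thesis using fx by linarith
qed

text \<open>A set of diameter at most \<open>L / 4 ^ m\<close> meets at most \<open>L + 2\<close>
  cells of level \<open>m\<close>.\<close>

lemma frostman_weight_interval:
  assumes "frostman_weight \<theta> n S w" "m \<le> n" "X \<subseteq> S" "0 \<le> L" "0 \<le> \<theta>"
    and "\<And>x y. x \<in> X \<Longrightarrow> y \<in> X \<Longrightarrow> 4 ^ m * \<bar>x - y\<bar> \<le> L"
  shows "(\<Sum>x\<in>X. w x) \<le> (L + 2) * \<theta> ^ m"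
proof -
  define f where "f x = \<lfloor>4 ^ m * (x::real)\<rfloor>" for x
  have w: "finite S" "\<And>x. 0 \<le> w x" "\<And>i. (\<Sum>x\<in>S \<inter> cell (m, i). w x) \<le> \<theta> ^ m"
    using assms(1,2) by (auto simp: frostman_weight_def)
  then have fin: "finite X" using assms(3) finite_subset by blast
  have "(\<Sum>x\<in>X. w x) = (\<Sum>i\<in>f ` X. \<Sum>x\<in>{x \<in> X. f x = i}. w x)"
    by (rule sum.image_gen[OF fin])
  also have "\<dots> \<le> (\<Sum>i\<in>f ` X. \<Sum>x\<in>S \<inter> cell (m, i). w x)"
    using w assms(3) by (intro sum_mono sum_mono2) (auto simp: f_def)
  also have "\<dots> \<le> (\<Sum>i\<in>f ` X. \<theta> ^ m)" by (intro sum_mono w(3))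
  also have "\<dots> = real (card (f ` X)) * \<theta> ^ m" by simp
  also have "\<dots> \<le> (L + 1 + 1) * \<theta> ^ m"
  proof (intro mult_right_mono card_spread_le)
    fix a b assume "a \<in> f ` X" "b \<in> f ` X"
    then obtain x y where xy: "x \<in> X" "y \<in> X" "a = f x" "b = f y" by blast
    have "\<bar>4 ^ m * x - 4 ^ m * y\<bar> \<le> L"
      using assms(6)[OF xy(1,2)] by (simp add: abs_mult flip: right_diff_distrib)
    then show "\<bar>real_of_int a - real_of_int b\<bar> \<le> L + 1" unfolding xy f_def by linarith
  qed (use fin assms in auto)
  finally show ?thesis by (simp add: add.commute)
qed

text \<open>The exceptional quadruples of Kaufman's argument: the affine function of
  \<open>x\<close> in \<open>quads\<close> is small at both ends, so its smallness inside says
  little about \<open>x\<close>.\<close>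

definition near_quads :: "nat \<Rightarrow> nat \<Rightarrow> ((int \<times> int) \<times> (int \<times> int)) set" where
  "near_quads n j = {(d, e). d \<in> digit_pairs n \<and> e \<in> digit_pairs n \<and>
     \<bar>diff d\<bar> \<le> 2 * 4 ^ (n - j) \<and> \<bar>diff e\<bar> \<le> 2 * 4 ^ (n - j)}"

text \<open>The two differences are independent, so the bound for close pairs is squared; the decay
  \<open>(1 / 4) ^ j\<close> reflects that \<open>C \<times> C\<close> has dimension 1.\<close>

lemma card_near_quads:
  assumes "j \<le> n"
  shows "real (card (near_quads n j)) \<le> 16 ^ n * (1 / 4) ^ j"
proof -
  define C where "C = {(p, p'). p \<in> digit_ints n \<and> p' \<in> digit_ints n \<and> \<bar>p - p'\<bar> \<le> 2 * 4 ^ (n - j)}"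
  have "near_quads n j = C \<times> C"
    by (auto simp: near_quads_def C_def digit_pairs_def diff_def)
  then have "card (near_quads n j) = card C * card C" by (simp add: card_cartesian_product)
  also have "\<dots> \<le> (2 ^ n * 2 ^ (n - j)) * (2 ^ n * 2 ^ (n - j))"
    unfolding C_def by (intro mult_le_mono card_close_pairs assms)
  finally have "real (card (near_quads n j)) \<le> (2 ^ n * 2 ^ (n - j)) * (2 ^ n * 2 ^ (n - j))"
    by (metis (mono_tags) of_nat_le_iff of_nat_mult of_nat_numeral of_nat_power)
  also have "\<dots> = 4 ^ n * 4 ^ (n - j)"
  proof -
    have "(2::real) ^ i * 2 ^ i = 4 ^ i" for i by (simp flip: power_mult_distrib)
    then show ?thesis by (metis mult.assoc mult.left_commute)
  qed
  also have "\<dots> = 16 ^ n * (1 / 4) ^ j"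
    using assms by (simp add: power_diff power_one_over field_simps flip: power_mult_distrib)
  finally show ?thesis .
qed

text \<open>With \<open>j\<close> the last level at which the quadruple is near, transversality
  confines \<open>x\<close> to a set of diameter \<open>32 * 4 ^ (- (k - j))\<close>, of weight at
  most \<open>34 * \<theta> ^ (k - j)\<close>. The sum over all levels replaces this single term so
  that summation over quadruples becomes a count.\<close>

lemma frostman_weight_near_direction:
  assumes fw: "frostman_weight \<theta> n S w" and "0 \<le> \<theta>" "k \<le> n"
    and t: "d \<in> digit_pairs n" "e \<in> digit_pairs n"
  shows "(\<Sum>x\<in>{x \<in> S. (d, e) \<in> quads n k x}. w x)
         \<le> 34 * (\<Sum>j\<le>k. \<theta> ^ (k - j) * of_bool ((d, e) \<in> near_quads n j))"
proof -
  define J where "J = {j. j \<le> k \<and> (d, e) \<in> near_quads n j}"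
  \<comment> \<open>Level 0 always qualifies, so a last level exists.\<close>
  have "\<bar>diff c\<bar> \<le> 2 * 4 ^ n" if "c \<in> digit_pairs n" for c
  proof -
    have "fst c \<in> digit_ints n" "snd c \<in> digit_ints n" using that by (auto simp: digit_pairs_def)
    from this[THEN digit_ints_bounds] show ?thesis by (auto simp: diff_def)
  qed
  then have "\<bar>diff d\<bar> \<le> 2 * 4 ^ n" "\<bar>diff e\<bar> \<le> 2 * 4 ^ n" using t by blast+
  then have J: "finite J" "J \<noteq> {}" using t by (auto simp: J_def near_quads_def intro!: exI[of _ 0])
  define j where "j = Max J"
  have "j \<in> J" unfolding j_def using J by simp
  then have jk: "j \<le> k" "(d, e) \<in> near_quads n j" by (auto simp: J_def)
  have "(\<Sum>x\<in>{x \<in> S. (d, e) \<in> quads n k x}. w x) \<le> (32 + 2) * \<theta> ^ (k - j)"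
  proof (rule frostman_weight_interval[OF fw])
    fix x y assume "x \<in> {x \<in> S. (d, e) \<in> quads n k x}" "y \<in> {x \<in> S. (d, e) \<in> quads n k x}"
    then have xy: "x \<in> {0..1}" "y \<in> {0..1}"
      and fx: "\<bar>(1 - x) * diff d + x * (diff e / 2)\<bar> \<le> 2 * 4 ^ (n - k)"
      and fy: "\<bar>(1 - y) * diff d + y * (diff e / 2)\<bar> \<le> 2 * 4 ^ (n - k)"
      using fw by (auto simp: quads_def frostman_weight_def)
    show "4 ^ (k - j) * \<bar>x - y\<bar> \<le> 32"
    proof (cases "j = k")
      case True
      then show ?thesis using xy by (auto simp: abs_le_iff)
    next
      case False
      then have "Suc j \<le> k" using jk by simp
      \<comment> \<open>Failure at the next level makes one end value at least
        \<open>4 ^ (n - Suc j)\<close>; the factor 2 in \<open>near_quads\<close> absorbs the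
        halving of \<open>diff e\<close>. Transversality gives 8 at level \<open>k - Suc j\<close>,
        hence 32 at level \<open>k - j\<close>.\<close>
      moreover have "Suc j \<notin> J" using Max_ge[OF J(1), of "Suc j"] unfolding j_def by linarith
      ultimately have "2 * 4 ^ (n - Suc j) < \<bar>diff d\<bar> \<or> 2 * 4 ^ (n - Suc j) < \<bar>diff e\<bar>"
        using t by (auto simp: J_def near_quads_def)
      then have "real_of_int (2 * 4 ^ (n - Suc j)) < real_of_int \<bar>diff d\<bar> \<or>
          real_of_int (2 * 4 ^ (n - Suc j)) < real_of_int \<bar>diff e\<bar>"
        by (simp only: of_int_less_iff)
      then have "4 ^ (n - Suc j) \<le> \<bar>real_of_int (diff d)\<bar> \<or> 4 ^ (n - Suc j) \<le> \<bar>real_of_int (diff e) / 2\<bar>"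
        by (auto simp: field_simps)
      then have "4 ^ (n - Suc j) * \<bar>x - y\<bar> \<le> 4 * (2 * 4 ^ (n - k))"
        by (rule affine_small_set[OF xy _ fx fy])
      moreover have "n - Suc j = (n - k) + (k - Suc j)" using \<open>Suc j \<le> k\<close> \<open>k \<le> n\<close> by simp
      ultimately have "4 ^ (n - k) * (4 ^ (k - Suc j) * \<bar>x - y\<bar>) \<le> 4 ^ (n - k) * 8"
        by (simp add: power_add mult_ac)
      then have "4 ^ (k - Suc j) * \<bar>x - y\<bar> \<le> 8" by simp
      moreover have "k - j = Suc (k - Suc j)" using \<open>Suc j \<le> k\<close> by simp
      ultimately show ?thesis by (simp add: mult.commute)
    qed
  qed (use assms in auto)
  also have "\<theta> ^ (k - j) = (\<Sum>i\<in>{j}. \<theta> ^ (k - i) * of_bool ((d, e) \<in> near_quads n i))"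
    using jk by simp
  also have "\<dots> \<le> (\<Sum>i\<le>k. \<theta> ^ (k - i) * of_bool ((d, e) \<in> near_quads n i))"
    using jk assms(2) by (intro sum_mono2) auto
  finally show ?thesis by simp
qed

text \<open>After exchanging the sums, the counts of near quadruples produce a geometric series of
  ratio \<open>1 / (4 * \<theta>)\<close>. It converges because \<open>1 / 4 < \<theta>\<close>,
  that is, because the Frostman exponent is below 1.\<close>

lemma frostman_weight_quads:
  assumes fw: "frostman_weight \<theta> n S w" and "1 / 4 < \<theta>" "k \<le> n"
  shows "(\<Sum>x\<in>S. w x * card (quads n k x)) \<le> 34 / (1 - 1 / (4 * \<theta>)) * 16 ^ n * \<theta> ^ k"
proof -
  define T where "T = digit_pairs n \<times> digit_pairs n"
  have S: "finite S" using fw by (simp add: frostman_weight_def)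
  have T: "finite T" by (simp add: T_def)
  have cnt: "real (card Q) = (\<Sum>t\<in>T. of_bool (t \<in> Q))" if "Q \<subseteq> T" for Q
    using T that by (simp add: Int_absorb1 Int_def[symmetric] inf.absorb2)
  have sub: "near_quads n j \<subseteq> T" for j by (auto simp: near_quads_def T_def)
  have "(\<Sum>x\<in>S. w x * card (quads n k x)) = (\<Sum>x\<in>S. \<Sum>t\<in>T. w x * of_bool (t \<in> quads n k x))"
    by (simp only: cnt[OF quads_subset[of n k, folded T_def]] sum_distrib_left)
  also have "\<dots> = (\<Sum>t\<in>T. \<Sum>x\<in>S. w x * of_bool (t \<in> quads n k x))" by (rule sum.swap)
  also have "\<dots> = (\<Sum>t\<in>T. \<Sum>x\<in>{x \<in> S. t \<in> quads n k x}. w x)"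
    by (intro sum.cong[OF refl], subst sum.inter_filter[OF S]) (intro sum.cong, auto)
  also have "\<dots> \<le> (\<Sum>t\<in>T. 34 * (\<Sum>j\<le>k. \<theta> ^ (k - j) * of_bool (t \<in> near_quads n j)))"
  proof (intro sum_mono)
    fix t assume "t \<in> T"
    then obtain d e where "t = (d, e)" "d \<in> digit_pairs n" "e \<in> digit_pairs n"
      unfolding T_def by blast
    then show "(\<Sum>x\<in>{x \<in> S. t \<in> quads n k x}. w x)
        \<le> 34 * (\<Sum>j\<le>k. \<theta> ^ (k - j) * of_bool (t \<in> near_quads n j))"
      using frostman_weight_near_direction[OF fw, of k d e] assms by simp
  qed
  also have "\<dots> = 34 * (\<Sum>j\<le>k. \<Sum>t\<in>T. \<theta> ^ (k - j) * of_bool (t \<in> near_quads n j))"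
    by (simp only: sum_distrib_left) (rule sum.swap)
  also have "\<dots> = 34 * (\<Sum>j\<le>k. \<theta> ^ (k - j) * card (near_quads n j))"
    by (simp only: sum_distrib_left[symmetric] cnt[OF sub])
  also have "\<dots> \<le> 34 * (\<Sum>j\<le>k. \<theta> ^ (k - j) * (16 ^ n * (1 / 4) ^ j))"
    using assms by (intro mult_left_mono sum_mono card_near_quads) auto
  also have "\<dots> = 34 * (16 ^ n * \<theta> ^ k) * (\<Sum>j\<le>k. (1 / (4 * \<theta>)) ^ j)"
  proof -
    have "\<theta> ^ (k - j) * (16 ^ n * (1 / 4) ^ j) = 16 ^ n * \<theta> ^ k * (1 / (4 * \<theta>)) ^ j" if "j \<le> k" for j
      using that assms(2) by (simp add: power_diff power_one_over power_mult_distrib field_simps)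
    then have "(\<Sum>j\<le>k. \<theta> ^ (k - j) * (16 ^ n * (1 / 4) ^ j)) = (\<Sum>j\<le>k. 16 ^ n * \<theta> ^ k * (1 / (4 * \<theta>)) ^ j)"
      by (intro sum.cong) auto
    then show ?thesis by (simp only: sum_distrib_left[symmetric] mult.assoc)
  qed
  also have "\<dots> \<le> 34 * (16 ^ n * \<theta> ^ k) * (1 / (1 - 1 / (4 * \<theta>)))"
  proof (rule mult_left_mono)
    have "1 / (4 * \<theta>) < 1" "0 \<le> 1 / (4 * \<theta>)" using assms(2) by auto
    then show "(\<Sum>j\<le>k. (1 / (4 * \<theta>)) ^ j) \<le> 1 / (1 - 1 / (4 * \<theta>))"
      using sum_le_suminf[OF summable_geometric, of "1 / (4 * \<theta>)" "{..k}"]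
      by (simp add: suminf_geometric)
  qed (use assms(2) in auto)
  finally show ?thesis by (simp add: mult_ac)
qed

section \<open>Energy and finite covers\<close>

text \<open>The energy method. \<open>c\<close> assigns each point to one cover set; by
  Cauchy--Schwarz the squared total mass is at most the weighted sum of squared masses of the cover
  sets times the cost of the cover. A squared mass counts pairs in one set, which are near at its
  level. For \<open>\<sigma> = 4 powr s\<close> the first factor is a discrete
  \<open>s\<close>-energy.\<close>

lemma energy_cover_bound:
  fixes \<nu> :: "'a \<Rightarrow> real" and c :: "'a \<Rightarrow> 'b" and k :: "'b \<Rightarrow> nat"
  assumes fin: "finite \<Omega>" "finite I" and nonneg: "\<And>P. 0 \<le> \<nu> P" and "0 < \<sigma>"
    and c: "\<And>P. P \<in> \<Omega> \<Longrightarrow> c P \<in> I" and k: "\<And>i. i \<in> I \<Longrightarrow> k i \<le> n"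
    and near: "\<And>P Q. P \<in> \<Omega> \<Longrightarrow> Q \<in> \<Omega> \<Longrightarrow> c P = c Q \<Longrightarrow> near (k (c P)) P Q"
  shows "(\<Sum>P\<in>\<Omega>. \<nu> P)\<^sup>2
    \<le> (\<Sum>j\<le>n. \<sigma> ^ j * (\<Sum>P\<in>\<Omega>. \<Sum>Q\<in>\<Omega>. \<nu> P * \<nu> Q * of_bool (near j P Q))) * (\<Sum>i\<in>I. (1 / \<sigma>) ^ k i)"
    (is "_ \<le> ?E * _")
proof -
  define m where "m i = (\<Sum>P\<in>{P \<in> \<Omega>. c P = i}. \<nu> P)" for i
  have grp: "(\<Sum>i\<in>I. \<Sum>P\<in>{P \<in> \<Omega>. c P = i}. h P) = (\<Sum>P\<in>\<Omega>. h P)" for h :: "'a \<Rightarrow> real"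
    using fin c by (intro sum.group) auto
  have "(\<Sum>P\<in>\<Omega>. \<nu> P)\<^sup>2 = (\<Sum>i\<in>I. (m i * sqrt (\<sigma> ^ k i)) * sqrt ((1 / \<sigma>) ^ k i))\<^sup>2"
  proof -
    have "sqrt (\<sigma> ^ k i) * sqrt ((1 / \<sigma>) ^ k i) = 1" for i
      using \<open>0 < \<sigma>\<close> by (simp flip: real_sqrt_mult power_mult_distrib)
    then show ?thesis by (simp add: m_def grp[of \<nu>] mult.assoc)
  qed
  also have "\<dots> \<le> (\<Sum>i\<in>I. (m i * sqrt (\<sigma> ^ k i))\<^sup>2) * (\<Sum>i\<in>I. (sqrt ((1 / \<sigma>) ^ k i))\<^sup>2)"
    by (rule Cauchy_Schwarz_ineq_sum)
  also have "\<dots> = (\<Sum>i\<in>I. (m i)\<^sup>2 * \<sigma> ^ k i) * (\<Sum>i\<in>I. (1 / \<sigma>) ^ k i)"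
    using \<open>0 < \<sigma>\<close> by (simp add: power_mult_distrib)
  also have "(\<Sum>i\<in>I. (m i)\<^sup>2 * \<sigma> ^ k i)
      = (\<Sum>i\<in>I. \<Sum>P\<in>{P \<in> \<Omega>. c P = i}. \<nu> P * (m (c P) * \<sigma> ^ k (c P)))"
  proof (intro sum.cong refl)
    fix i
    have "(\<Sum>P\<in>{P \<in> \<Omega>. c P = i}. \<nu> P * (m (c P) * \<sigma> ^ k (c P)))
        = (\<Sum>P\<in>{P \<in> \<Omega>. c P = i}. \<nu> P * (m i * \<sigma> ^ k i))" by (intro sum.cong) auto
    also have "\<dots> = m i * (m i * \<sigma> ^ k i)" unfolding m_def[of i] by (rule sum_distrib_right[symmetric])
    finally show "(m i)\<^sup>2 * \<sigma> ^ k i = (\<Sum>P\<in>{P \<in> \<Omega>. c P = i}. \<nu> P * (m (c P) * \<sigma> ^ k (c P)))"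
      by (simp add: power2_eq_square mult.assoc)
  qed
  also have "\<dots> = (\<Sum>P\<in>\<Omega>. \<nu> P * (m (c P) * \<sigma> ^ k (c P)))" by (rule grp)
  also have "\<dots> = (\<Sum>P\<in>\<Omega>. \<Sum>Q\<in>\<Omega>. \<nu> P * \<nu> Q * (of_bool (c Q = c P) * \<sigma> ^ k (c P)))"
  proof (intro sum.cong refl)
    fix P
    have "m (c P) = (\<Sum>Q\<in>\<Omega>. \<nu> Q * of_bool (c Q = c P))"
      unfolding m_def by (subst sum.inter_filter[OF fin(1)]) (intro sum.cong, auto)
    then show "\<nu> P * (m (c P) * \<sigma> ^ k (c P)) = (\<Sum>Q\<in>\<Omega>. \<nu> P * \<nu> Q * (of_bool (c Q = c P) * \<sigma> ^ k (c P)))"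
      by (simp only: sum_distrib_left sum_distrib_right mult.assoc)
  qed
  also have "\<dots> \<le> (\<Sum>P\<in>\<Omega>. \<Sum>Q\<in>\<Omega>. \<nu> P * \<nu> Q * (\<Sum>j\<le>n. \<sigma> ^ j * of_bool (near j P Q)))"
  proof (intro sum_mono mult_left_mono)
    fix P Q assume PQ: "P \<in> \<Omega>" "Q \<in> \<Omega>"
    \<comment> \<open>Only the term \<open>j = k (c P)\<close> of the sum is kept.\<close>
    have "\<sigma> ^ k (c P) * of_bool (near (k (c P)) P Q) \<le> (\<Sum>j\<le>n. \<sigma> ^ j * of_bool (near j P Q))"
      using \<open>0 < \<sigma>\<close> c k PQ by (intro member_le_sum) auto
    moreover have "0 \<le> (\<Sum>j\<le>n. \<sigma> ^ j * of_bool (near j P Q))"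
      using \<open>0 < \<sigma>\<close> by (intro sum_nonneg) auto
    ultimately show "of_bool (c Q = c P) * \<sigma> ^ k (c P) \<le> (\<Sum>j\<le>n. \<sigma> ^ j * of_bool (near j P Q))"
      using near[OF PQ] by (cases "c Q = c P") auto
  qed (use nonneg in auto)
  also have "\<dots> = (\<Sum>P\<in>\<Omega>. \<Sum>j\<le>n. \<Sum>Q\<in>\<Omega>. \<sigma> ^ j * (\<nu> P * \<nu> Q * of_bool (near j P Q)))"
    unfolding sum_distrib_left
    by (intro sum.cong[OF refl], subst sum.swap, intro sum.cong[OF refl]) (simp only: mult_ac)
  also have "\<dots> = ?E"
    by (subst sum.swap) (simp only: sum_distrib_left)
  finally show ?thesis using \<open>0 < \<sigma>\<close> by (simp add: mult_right_mono sum_nonneg)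
qed

text \<open>The arguments \<open>p\<close> and \<open>q\<close> are the parameters \<open>c1\<close> and \<open>c2\<close> scaled by \<open>4 ^ n\<close>.\<close>

definition seg_point :: "nat \<Rightarrow> real \<times> int \<times> int \<Rightarrow> real \<times> real" where
  "seg_point n = (\<lambda>(x, p, q). (x, (1 - x) * (p / 4 ^ n) + x * (q / 4 ^ n) / 2))"

text \<open>The first coordinates put \<open>x\<close> and \<open>x'\<close> within
  \<open>4 ^ (- k)\<close>. Moving the second point from \<open>x'\<close> to \<open>x\<close> with
  fixed parameters changes its height by at most another \<open>4 ^ (- k)\<close>, whence the factor
  2 in \<open>quads\<close>.\<close>

lemma card_near_points:
  assumes "k \<le> n" "x' \<in> {0..1}"
  shows "(\<Sum>a\<in>digit_pairs n. \<Sum>b\<in>digit_pairs n.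
            of_bool (dist (seg_point n (x, a)) (seg_point n (x', b)) \<le> (1 / 4) ^ k))
         \<le> real (card (quads n k x)) * of_bool (4 ^ k * \<bar>x - x'\<bar> \<le> 1)"
proof -
  define B where "B = {(a, b). a \<in> digit_pairs n \<and> b \<in> digit_pairs n \<and>
      dist (seg_point n (x, a)) (seg_point n (x', b)) \<le> (1 / 4) ^ k}"
  have "B = (SIGMA a:digit_pairs n. {b \<in> digit_pairs n.
      dist (seg_point n (x, a)) (seg_point n (x', b)) \<le> (1 / 4) ^ k})" by (auto simp: B_def)
  then have "real (card B) = (\<Sum>a\<in>digit_pairs n. real (card {b \<in> digit_pairs n.
      dist (seg_point n (x, a)) (seg_point n (x', b)) \<le> (1 / 4) ^ k}))" by simp
  then have B: "real (card B) = (\<Sum>a\<in>digit_pairs n. \<Sum>b\<in>digit_pairs n.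
            of_bool (dist (seg_point n (x, a)) (seg_point n (x', b)) \<le> (1 / 4) ^ k))"
    by (simp only: real_card_eq_sum_of_bool[OF finite_digit_pairs])
  have n: "(4::real) ^ n * (1 / 4) ^ k = 4 ^ (n - k)"
    using assms(1) by (simp add: power_diff power_one_over field_simps)
  have key: "4 ^ k * \<bar>x - x'\<bar> \<le> 1 \<and> ((p, p'), (q, q')) \<in> quads n k x"
    if "((p, q), (p', q')) \<in> B" for p q p' q'
  proof -
    from that have mem: "p \<in> digit_ints n" "q \<in> digit_ints n" "p' \<in> digit_ints n" "q' \<in> digit_ints n"
      and d: "dist (seg_point n (x, p, q)) (seg_point n (x', p', q')) \<le> (1 / 4) ^ k"
      by (auto simp: B_def digit_pairs_def)
    define y y' where "y = (1 - x) * p + x * q / 2" and "y' = (1 - x') * p' + x' * q' / 2"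
    have dx: "\<bar>x - x'\<bar> \<le> (1 / 4) ^ k"
      using order.trans[OF dist_fst_le d] by (simp add: seg_point_def dist_real_def)
    have "snd (seg_point n (x, p, q)) - snd (seg_point n (x', p', q')) = (y - y') / 4 ^ n"
      by (simp add: seg_point_def y_def y'_def field_simps)
    then have "\<bar>y - y'\<bar> / 4 ^ n \<le> (1 / 4) ^ k"
      using order.trans[OF dist_snd_le d] by (simp add: dist_real_def abs_divide)
    then have dy: "\<bar>y - y'\<bar> \<le> 4 ^ (n - k)" by (simp add: field_simps flip: n)
    have "0 \<le> real_of_int r \<and> real_of_int r \<le> 4 ^ n" if "r \<in> digit_ints n" for r
      using digit_ints_bounds[OF that] by (metis of_int_0_le_iff of_int_le_iff of_int_numeral of_int_power less_imp_le)
    from this[OF mem(3)] this[OF mem(4)] have "\<bar>q' / 2 - p'\<bar> \<le> 4 ^ n" by linarith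
    with dx have "\<bar>x' - x\<bar> * \<bar>q' / 2 - p'\<bar> \<le> (1 / 4) ^ k * 4 ^ n"
      by (intro mult_mono) auto
    then have "\<bar>(x' - x) * (q' / 2 - p')\<bar> \<le> 4 ^ (n - k)" by (simp add: abs_mult mult.commute flip: n)
    moreover have "(1 - x) * diff (p, p') + x * diff (q, q') / 2 = (y - y') + (x' - x) * (q' / 2 - p')"
      by (simp add: y_def y'_def diff_def field_simps)
    ultimately have "\<bar>(1 - x) * diff (p, p') + x * diff (q, q') / 2\<bar> \<le> 2 * 4 ^ (n - k)"
      using dy by linarith
    moreover have "4 ^ k * \<bar>x - x'\<bar> \<le> 1" using dx by (simp add: power_one_over field_simps)
    ultimately show ?thesis using mem by (simp add: quads_def digit_pairs_def)
  qed
  \<comment> \<open>Regrouping: from the parameters of two points to the two values of each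
    parameter.\<close>
  have "B \<subseteq> (\<lambda>((p, p'), (q, q')). ((p, q), (p', q'))) ` quads n k x"
  proof
    fix t assume t: "t \<in> B"
    obtain p q p' q' where "t = ((p, q), (p', q'))" by (metis surj_pair)
    with key[of p q p' q'] t show "t \<in> (\<lambda>((p, p'), (q, q')). ((p, q), (p', q'))) ` quads n k x"
      by (intro rev_image_eqI[of "((p, p'), (q, q'))"]) auto
  qed
  then have "card B \<le> card (quads n k x)" by (intro surj_card_le) auto
  moreover have "B = {}" if "\<not> 4 ^ k * \<bar>x - x'\<bar> \<le> 1" using key that by fast
  ultimately show ?thesis unfolding B[symmetric] by auto
qed

text \<open>For fixed \<open>x\<close> the number of parameter choices is bounded independently of
  \<open>x'\<close>, and the admissible \<open>x'\<close> have mutual distances at most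
  \<open>2 * 4 ^ (- k)\<close>, hence weight at most \<open>(2 + 2) * \<theta> ^ k\<close>.\<close>

lemma frostman_weight_energy:
  assumes fw: "frostman_weight \<theta> n S w" and "0 \<le> \<theta>" "k \<le> n"
  defines "\<Omega> \<equiv> S \<times> digit_pairs n"
  shows "(\<Sum>P\<in>\<Omega>. \<Sum>Q\<in>\<Omega>. w (fst P) * w (fst Q) *
            of_bool (dist (seg_point n P) (seg_point n Q) \<le> (1 / 4) ^ k))
         \<le> 4 * \<theta> ^ k * (\<Sum>x\<in>S. w x * card (quads n k x))"
proof -
  have w: "0 \<le> w x" for x using fw by (simp add: frostman_weight_def)
  have S: "finite S" "S \<subseteq> {0..1}" using fw by (auto simp: frostman_weight_def)
  have prod: "(\<Sum>P\<in>\<Omega>. h P) = (\<Sum>x\<in>S. \<Sum>a\<in>digit_pairs n. h (x, a))" for h :: "_ \<Rightarrow> real"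
    unfolding \<Omega>_def by (simp add: sum.cartesian_product)
  have "(\<Sum>P\<in>\<Omega>. \<Sum>Q\<in>\<Omega>. w (fst P) * w (fst Q) *
            of_bool (dist (seg_point n P) (seg_point n Q) \<le> (1 / 4) ^ k))
      = (\<Sum>x\<in>S. \<Sum>x'\<in>S. \<Sum>a\<in>digit_pairs n. \<Sum>b\<in>digit_pairs n. w x * w x' *
            of_bool (dist (seg_point n (x, a)) (seg_point n (x', b)) \<le> (1 / 4) ^ k))"
    unfolding prod fst_conv by (intro sum.cong[OF refl] sum.swap)
  also have "\<dots> = (\<Sum>x\<in>S. \<Sum>x'\<in>S. w x * w x' * (\<Sum>a\<in>digit_pairs n. \<Sum>b\<in>digit_pairs n.
            of_bool (dist (seg_point n (x, a)) (seg_point n (x', b)) \<le> (1 / 4) ^ k)))"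
    by (simp only: sum_distrib_left)
  also have "\<dots> \<le> (\<Sum>x\<in>S. \<Sum>x'\<in>S. w x * w x' * (real (card (quads n k x)) * of_bool (4 ^ k * \<bar>x - x'\<bar> \<le> 1)))"
    using assms(3) S w by (intro sum_mono mult_left_mono card_near_points) auto
  also have "\<dots> = (\<Sum>x\<in>S. w x * real (card (quads n k x)) * (\<Sum>x'\<in>S. w x' * of_bool (4 ^ k * \<bar>x - x'\<bar> \<le> 1)))"
    by (simp add: sum_distrib_left mult_ac)
  also have "\<dots> \<le> (\<Sum>x\<in>S. w x * real (card (quads n k x)) * (4 * \<theta> ^ k))"
  proof (intro sum_mono mult_left_mono)
    fix x
    have "(\<Sum>x'\<in>S. w x' * of_bool (4 ^ k * \<bar>x - x'\<bar> \<le> 1)) = (\<Sum>x'\<in>{x' \<in> S. 4 ^ k * \<bar>x - x'\<bar> \<le> 1}. w x')"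
      by (subst sum.inter_filter[OF S(1)]) (intro sum.cong, auto)
    also have "\<dots> \<le> (2 + 2) * \<theta> ^ k"
    proof (rule frostman_weight_interval[OF fw])
      fix y z assume "y \<in> {x' \<in> S. 4 ^ k * \<bar>x - x'\<bar> \<le> 1}" "z \<in> {x' \<in> S. 4 ^ k * \<bar>x - x'\<bar> \<le> 1}"
      moreover have "4 ^ k * \<bar>y - z\<bar> \<le> 4 ^ k * (\<bar>x - y\<bar> + \<bar>x - z\<bar>)" by (intro mult_left_mono) auto
      ultimately show "4 ^ k * \<bar>y - z\<bar> \<le> 2" unfolding distrib_left by simp
    qed (use assms in auto)
    finally show "(\<Sum>x'\<in>S. w x' * of_bool (4 ^ k * \<bar>x - x'\<bar> \<le> 1)) \<le> 4 * \<theta> ^ k" by simp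
  qed (use w in auto)
  also have "\<dots> = 4 * \<theta> ^ k * (\<Sum>x\<in>S. w x * card (quads n k x))"
    by (simp add: sum_distrib_left mult_ac)
  finally show ?thesis .
qed

lemma seg_point_in_segment_set:
  assumes "x \<in> K" "a \<in> digit_pairs n"
  shows "seg_point n (x, a) \<in> segment_set K"
proof -
  obtain p q where a: "a = (p, q)" "p \<in> digit_ints n" "q \<in> digit_ints n"
    using assms(2) by (auto simp: digit_pairs_def)
  then have "p / 4 ^ n \<in> cantor_set" "q / 4 ^ n \<in> cantor_set" by (simp_all add: digit_ints_cantor_set)
  then show ?thesis using assms(1) unfolding segment_set_def seg_point_def a(1) prod.case by blast
qed

text \<open>Shared by both estimates, with \<open>g = 3 / 8\<close> or \<open>g = \<theta>\<close>.
  The energy at level \<open>j\<close> is at most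
  \<open>4 * C * 16 ^ n * (\<theta> * g) ^ j\<close>, so the weighted sum is a convergent geometric
  series, and \<open>16 ^ n\<close> cancels against the squared mass.\<close>

lemma segment_set_cover_bound:
  fixes V :: "'i \<Rightarrow> (real \<times> real) set" and k :: "'i \<Rightarrow> nat"
  assumes wt: "\<And>n. \<exists>S w. frostman_weight \<theta> n S w \<and> S \<subseteq> K \<and> \<kappa> \<le> (\<Sum>x\<in>S. w x) \<and>
      (\<forall>k\<le>n. (\<Sum>x\<in>S. w x * card (quads n k x)) \<le> C * 16 ^ n * g ^ k)"
    and pos: "0 < \<kappa>" "0 < C" "0 \<le> \<theta>" "0 \<le> g" "0 < \<sigma>" "\<sigma> * \<theta> * g < 1"
    and cov: "finite I" "segment_set K \<subseteq> (\<Union>i\<in>I. V i)"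
    and diam: "\<And>i p q. i \<in> I \<Longrightarrow> p \<in> V i \<Longrightarrow> q \<in> V i \<Longrightarrow> dist p q \<le> (1 / 4) ^ k i"
  shows "\<kappa>\<^sup>2 * (1 - \<sigma> * \<theta> * g) / (4 * C) \<le> (\<Sum>i\<in>I. (1 / \<sigma>) ^ k i)"
proof -
  \<comment> \<open>The working level is chosen after the cover, as its finest level; hence weights
    for every \<open>n\<close> with common constants are assumed. The 0 serves an empty
    \<open>I\<close>.\<close>
  define n where "n = Max (insert 0 (k ` I))"
  have n: "k i \<le> n" if "i \<in> I" for i using that cov(1) by (simp add: n_def)
  obtain S w where fw: "frostman_weight \<theta> n S w" and S: "S \<subseteq> K" and mass: "\<kappa> \<le> (\<Sum>x\<in>S. w x)"
    and q: "\<And>k. k \<le> n \<Longrightarrow> (\<Sum>x\<in>S. w x * card (quads n k x)) \<le> C * 16 ^ n * g ^ k"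
    using wt[of n] by blast
  have fin: "finite S" and w: "\<And>x. 0 \<le> w x" using fw by (auto simp: frostman_weight_def)
  define \<Omega> where "\<Omega> = S \<times> digit_pairs n"
  define r where "r = \<sigma> * \<theta> * g"
  have r: "0 \<le> r" "r < 1" using pos by (auto simp: r_def)
  have "\<exists>i\<in>I. seg_point n P \<in> V i" if "P \<in> \<Omega>" for P
  proof -
    obtain x a where "P = (x, a)" "x \<in> S" "a \<in> digit_pairs n" using \<open>P \<in> \<Omega>\<close> unfolding \<Omega>_def by blast
    then have "seg_point n P \<in> segment_set K" using S by (auto intro: seg_point_in_segment_set)
    then show ?thesis using cov(2) by blast
  qed
  then obtain c where c: "\<And>P. P \<in> \<Omega> \<Longrightarrow> c P \<in> I" "\<And>P. P \<in> \<Omega> \<Longrightarrow> seg_point n P \<in> V (c P)"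
    by metis
  define X where "X = (\<Sum>i\<in>I. (1 / \<sigma>) ^ k i)"
  define G where "G j = (\<Sum>P\<in>\<Omega>. \<Sum>Q\<in>\<Omega>. w (fst P) * w (fst Q) *
            of_bool (dist (seg_point n P) (seg_point n Q) \<le> (1 / 4) ^ j))" for j
  have X: "0 \<le> X" using pos by (auto simp: X_def intro!: sum_nonneg)
  have "(\<Sum>P\<in>\<Omega>. w (fst P))\<^sup>2 \<le> (\<Sum>j\<le>n. \<sigma> ^ j * G j) * X"
    unfolding G_def X_def
  proof (rule energy_cover_bound[where c = c])
    show "dist (seg_point n P) (seg_point n Q) \<le> (1 / 4) ^ k (c P)"
      if "P \<in> \<Omega>" "Q \<in> \<Omega>" "c P = c Q" for P Q
      using that(3) by (intro diam c that(1)) (auto intro: c(2) that(2))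
    show "finite \<Omega>" using fin by (simp add: \<Omega>_def)
  qed (use c n pos w cov(1) in auto)
  also have "\<dots> \<le> (\<Sum>j\<le>n. 4 * C * 16 ^ n * r ^ j) * X"
  proof (intro mult_right_mono sum_mono)
    fix j assume "j \<in> {..n}"
    then have "G j \<le> 4 * \<theta> ^ j * (\<Sum>x\<in>S. w x * card (quads n j x))"
      unfolding G_def \<Omega>_def using fw pos(3) by (intro frostman_weight_energy) auto
    also have "\<dots> \<le> 4 * \<theta> ^ j * (C * 16 ^ n * g ^ j)"
      using q[of j] \<open>j \<in> {..n}\<close> pos(3) by (intro mult_left_mono) auto
    finally have "\<sigma> ^ j * G j \<le> \<sigma> ^ j * (4 * \<theta> ^ j * (C * 16 ^ n * g ^ j))"
      using pos(5) by (intro mult_left_mono) auto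
    then show "\<sigma> ^ j * G j \<le> 4 * C * 16 ^ n * r ^ j"
      by (simp add: r_def power_mult_distrib mult_ac)
  qed (rule X)
  also have "\<dots> = 4 * C * 16 ^ n * (\<Sum>j\<le>n. r ^ j) * X" by (simp add: sum_distrib_left)
  also have "\<dots> \<le> 4 * C * 16 ^ n * (1 / (1 - r)) * X"
  proof (intro mult_right_mono mult_left_mono X)
    show "(\<Sum>j\<le>n. r ^ j) \<le> 1 / (1 - r)"
      using sum_le_suminf[OF summable_geometric, of r "{..n}"] r by (simp add: suminf_geometric)
  qed (use pos in auto)
  finally have upper: "(\<Sum>P\<in>\<Omega>. w (fst P))\<^sup>2 \<le> 4 * C * 16 ^ n * (1 / (1 - r)) * X" .
  have "(\<Sum>P\<in>\<Omega>. w (fst P)) = (\<Sum>x\<in>S. \<Sum>a\<in>digit_pairs n. w x)"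
    by (simp only: \<Omega>_def sum.cartesian_product case_prod_unfold)
  also have "\<dots> = 4 ^ n * (\<Sum>x\<in>S. w x)"
    by (simp add: digit_pairs_def card_cartesian_product card_digit_ints sum_distrib_left
        flip: power_mult_distrib)
  finally have "\<kappa> * 4 ^ n \<le> (\<Sum>P\<in>\<Omega>. w (fst P))" using mass by (simp add: mult.commute)
  then have "(\<kappa> * 4 ^ n)\<^sup>2 \<le> 4 * C * 16 ^ n * (1 / (1 - r)) * X"
    using upper pos(1) by (meson order.trans power_mono mult_nonneg_nonneg less_imp_le zero_le_numeral zero_le_power)
  moreover have "(\<kappa> * 4 ^ n)\<^sup>2 = 16 ^ n * \<kappa>\<^sup>2"
    by (simp add: power_mult_distrib power2_eq_square flip: power_mult_distrib[of 4 4 n])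
  ultimately have "16 ^ n * \<kappa>\<^sup>2 \<le> 16 ^ n * (4 * C * (1 / (1 - r)) * X)" by (simp add: mult_ac)
  then have "\<kappa>\<^sup>2 \<le> 4 * C * (1 / (1 - r)) * X" by (rule mult_left_le_imp_le) simp
  then have "\<kappa>\<^sup>2 * (1 - r) / (4 * C) \<le> X" using r pos(2) by (simp add: field_simps)
  then show ?thesis by (simp add: r_def X_def)
qed

section \<open>Hausdorff measure and 4-adic content\<close>

lemma cell_dist: "x \<in> cell (m, i) \<Longrightarrow> y \<in> cell (m, i) \<Longrightarrow> \<bar>x - y\<bar> \<le> (1 / 4) ^ m"
proof -
  assume "x \<in> cell (m, i)" "y \<in> cell (m, i)"
  then have "\<bar>4 ^ m * x - 4 ^ m * y\<bar> \<le> 1" by simp linarith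
  then have "4 ^ m * \<bar>x - y\<bar> \<le> 1" by (simp add: abs_mult flip: right_diff_distrib)
  then show ?thesis by (simp add: power_one_over field_simps)
qed

lemma bounded_cell: "bounded (cell (m, i))"
proof (cases "cell (m, i) = {}")
  case False
  then obtain x where "x \<in> cell (m, i)" by blast
  then show ?thesis unfolding bounded_def by (metis cell_dist dist_real_def)
qed simp

lemma diameter_cell: "diameter (cell (m, i)) \<le> (1 / 4) ^ m"
  by (intro diameter_le) (auto simp del: mem_cell intro: cell_dist)

text \<open>Below the dimension some premeasure is positive, which bounds the cost of covers by
  cells of size at most \<open>\<delta>\<close>. A cover with a larger cell costs at least
  \<open>\<delta> powr a\<close> through that cell alone.\<close>

lemma content_ge_if_dim:
  assumes "0 < a" "ereal a < hausdorff_dim K"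
  obtains \<kappa> where "0 < \<kappa>" "content_ge (4 powr (- a)) \<kappa> K"
proof -
  have "hausdorff_measure a K \<noteq> 0"
  proof
    assume "hausdorff_measure a K = 0"
    then have "hausdorff_dim K \<le> ereal a"
      unfolding hausdorff_dim_def using assms(1) by (intro INF_lower) auto
    then show False using assms(2) by simp
  qed
  then obtain \<delta> where \<delta>: "0 < \<delta>" "hausdorff_premeasure a \<delta> K \<noteq> 0"
    unfolding hausdorff_measure_def by (metis (mono_tags, lifting) SUP_bot_conv(1) bot_ennreal greaterThan_iff)
  then have "0 < hausdorff_premeasure a \<delta> K" by (simp add: zero_less_iff_neq_zero)
  \<comment> \<open>The premeasure may be infinite; a smaller finite value takes its place.\<close>
  then obtain h where h: "0 < h" "h < hausdorff_premeasure a \<delta> K" using dense by blast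
  define \<kappa>0 where "\<kappa>0 = enn2real h"
  have "h < top" using h(2) order.strict_trans2 top_greatest by blast
  then have \<kappa>0: "0 < \<kappa>0" "ennreal \<kappa>0 = h" using h(1) by (auto simp: \<kappa>0_def enn2real_positive_iff)
  define \<kappa> where "\<kappa> = min \<kappa>0 (\<delta> powr a)"
  have th: "(4 powr (- a)) ^ m = ((1 / 4) ^ m) powr a" for m
    by (simp add: powr_realpow[symmetric] powr_powr powr_divide powr_minus_divide mult.commute)
  have "\<kappa> \<le> (\<Sum>t\<in>F. (4 powr (- a)) ^ fst t)" if F: "finite F" "K \<subseteq> (\<Union>t\<in>F. cell t)" for F
  proof (cases "\<exists>t\<in>F. \<delta> < (1 / 4) ^ fst t")
    case True
    then obtain t where t: "t \<in> F" "\<delta> < (1 / 4) ^ fst t" by blast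
    have "\<kappa> \<le> \<delta> powr a" by (simp add: \<kappa>_def)
    also have "\<dots> \<le> ((1 / 4) ^ fst t) powr a" using t(2) \<delta>(1) assms(1) by (intro powr_mono2) auto
    also have "\<dots> \<le> (\<Sum>t\<in>F. (4 powr (- a)) ^ fst t)"
      unfolding th[symmetric] using t(1) F(1) by (intro member_le_sum) auto
    finally show ?thesis .
  next
    case False
    obtain e where e: "bij_betw e {0..<card F} F" using ex_bij_betw_nat_finite[OF F(1)] by blast
    \<comment> \<open>Empty sets, of weight 0, extend the finite cover to a sequence.\<close>
    define U where "U j = (if j < card F then cell (e j) else {})" for j
    have U: "bounded (U j)" "diameter (U j) \<le> \<delta>" for j
    proof -
      show "bounded (U j)" using bounded_cell by (cases "e j") (auto simp: U_def)
      show "diameter (U j) \<le> \<delta>"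
      proof (cases "j < card F")
        case True
        then have "e j \<in> F" using e by (auto simp: bij_betw_def)
        then have "(1 / 4) ^ fst (e j) \<le> \<delta>" using False by force
        then show ?thesis using True diameter_cell[of "fst (e j)" "snd (e j)"] by (simp add: U_def)
      qed (use \<delta>(1) in \<open>simp add: U_def\<close>)
    qed
    have "K \<subseteq> (\<Union>j. U j)"
    proof
      fix x assume "x \<in> K"
      then obtain t where t: "t \<in> F" "x \<in> cell t" using F(2) by blast
      then obtain j where "j < card F" "e j = t"
        using bij_betw_imp_surj_on[OF e] by (metis atLeastLessThan_iff imageE)
      then show "x \<in> (\<Union>j. U j)" using t by (auto simp: U_def intro!: exI[of _ j])
    qed
    then have "hausdorff_premeasure a \<delta> K \<le> (\<Sum>j. diam_pow a (U j))"
      unfolding hausdorff_premeasure_def using U by (intro INF_lower) auto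
    also have "\<dots> = (\<Sum>j<card F. diam_pow a (U j))"
      by (intro suminf_finite) (auto simp: U_def diam_pow_def)
    also have "\<dots> \<le> (\<Sum>j<card F. ennreal ((4 powr (- a)) ^ fst (e j)))"
    proof (intro sum_mono)
      fix j assume j: "j \<in> {..<card F}"
      have "diameter (cell (e j)) powr a \<le> ((1 / 4) ^ fst (e j)) powr a"
        using diameter_cell[of "fst (e j)" "snd (e j)"] bounded_cell[of "fst (e j)" "snd (e j)"] assms(1)
        by (intro powr_mono2) (auto intro: diameter_ge_0)
      then show "diam_pow a (U j) \<le> ennreal ((4 powr (- a)) ^ fst (e j))"
        using j assms(1) by (auto simp: U_def diam_pow_def th intro: ennreal_leI)
    qed
    also have "\<dots> = ennreal (\<Sum>j<card F. (4 powr (- a)) ^ fst (e j))" by (simp add: sum_ennreal)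
    also have "(\<Sum>j<card F. (4 powr (- a)) ^ fst (e j)) = (\<Sum>t\<in>F. (4 powr (- a)) ^ fst t)"
      using sum.reindex_bij_betw[OF e, of "\<lambda>t. (4 powr (- a)) ^ fst t"] by (simp add: atLeast0LessThan)
    finally have "ennreal \<kappa>0 \<le> ennreal (\<Sum>t\<in>F. (4 powr (- a)) ^ fst t)" using h(2) \<kappa>0(2) by simp
    then have "\<kappa>0 \<le> (\<Sum>t\<in>F. (4 powr (- a)) ^ fst t)" by (subst (asm) ennreal_le_iff) (auto intro: sum_nonneg)
    then show ?thesis by (simp add: \<kappa>_def)
  qed
  then have "content_ge (4 powr (- a)) \<kappa> K" by (simp add: content_ge_def)
  moreover have "0 < \<kappa>" using \<kappa>0 \<delta> by (simp add: \<kappa>_def)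
  ultimately show ?thesis using that by blast
qed

text \<open>The additive-energy estimate degenerates at 0 and 1. The removed end pieces lie in three
  cells: the first, the last below 1, and, cells being half-open, the one starting at the point
  1.\<close>

lemma content_ge_interior:
  assumes "content_ge \<theta> \<kappa> K" "K \<subseteq> {0..1}" "0 < \<theta>"
  shows "content_ge \<theta> (\<kappa> - 3 * \<theta> ^ m) (K \<inter> {(1 / 4) ^ m .. 1 - (1 / 4) ^ m})"
  unfolding content_ge_def
proof (intro allI impI)
  fix F assume F: "finite F" "K \<inter> {(1 / 4) ^ m .. 1 - (1 / 4) ^ m} \<subseteq> (\<Union>t\<in>F. cell t)"
  define F' where "F' = insert (m, 0) (insert (m, 4 ^ m - 1) (insert (m, 4 ^ m) F))"
  have "K \<subseteq> (\<Union>t\<in>F'. cell t)"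
  proof
    fix x assume x: "x \<in> K"
    have z: "4 ^ m * (1 / 4 :: real) ^ m = 1" by (simp add: power_one_over)
    have x01: "0 \<le> x" "x \<le> 1" using x assms(2) by auto
    then have b: "0 \<le> 4 ^ m * x" "4 ^ m * x \<le> 4 ^ m" by (simp_all add: mult_left_le)
    consider "x < (1 / 4) ^ m" | "1 - (1 / 4) ^ m < x" | "(1 / 4) ^ m \<le> x" "x \<le> 1 - (1 / 4) ^ m" by linarith
    then show "x \<in> (\<Union>t\<in>F'. cell t)"
    proof cases
      case 1
      then have "4 ^ m * x < 4 ^ m * (1 / 4) ^ m" by (intro mult_strict_left_mono) auto
      then have "\<lfloor>4 ^ m * x\<rfloor> = 0" using b z by linarith
      then show ?thesis by (simp add: F'_def)
    next
      case 2
      then have "4 ^ m * (1 - (1 / 4) ^ m) < 4 ^ m * x" by (intro mult_strict_left_mono) auto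
      then have "4 ^ m - 1 < 4 ^ m * x" by (simp only: right_diff_distrib z)
      then have "\<lfloor>4 ^ m * x\<rfloor> = 4 ^ m - 1 \<or> \<lfloor>4 ^ m * x\<rfloor> = 4 ^ m"
        using b(2) x01(2) by (cases "x = 1") (auto simp: floor_eq_iff)
      then show ?thesis by (auto simp: F'_def)
    next
      case 3
      then show ?thesis using F(2) x by (auto simp: F'_def)
    qed
  qed
  then have lower: "\<kappa> \<le> (\<Sum>t\<in>F'. \<theta> ^ fst t)" using assms(1) F(1) by (simp add: content_ge_def F'_def)
  have ins: "(\<Sum>t\<in>insert u G. \<theta> ^ fst t) \<le> \<theta> ^ fst u + (\<Sum>t\<in>G. \<theta> ^ fst t)"
    if "finite G" for u :: "nat \<times> int" and G
    using that assms(3) by (cases "u \<in> G") (auto simp: insert_absorb)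
  have "(\<Sum>t\<in>F'. \<theta> ^ fst t)
      \<le> \<theta> ^ m + (\<Sum>t\<in>insert (m, 4 ^ m - 1) (insert (m, 4 ^ m) F). \<theta> ^ fst t)"
    unfolding F'_def using ins[of _ "(m, 0)"] F(1) by simp
  also have "\<dots> \<le> \<theta> ^ m + (\<theta> ^ m + (\<Sum>t\<in>insert (m, 4 ^ m) F. \<theta> ^ fst t))"
    using ins[of _ "(m, 4 ^ m - 1)"] F(1) by simp
  also have "\<dots> \<le> \<theta> ^ m + (\<theta> ^ m + (\<theta> ^ m + (\<Sum>t\<in>F. \<theta> ^ fst t)))"
    using ins[of F "(m, 4 ^ m)"] F(1) by simp
  finally show "\<kappa> - 3 * \<theta> ^ m \<le> (\<Sum>t\<in>F. \<theta> ^ fst t)" using lower by simp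
qed

section \<open>From Hausdorff measure zero to finite covers at 4-adic scales\<close>

lemma four_adic_scale:
  fixes \<rho> :: real
  assumes "0 < \<rho>" "\<rho> \<le> 1"
  obtains k where "\<rho> \<le> (1 / 4) ^ k" "(1 / 4) ^ k \<le> 4 * \<rho>"
proof -
  define m where "m = (LEAST n. (1 / 4) ^ n < \<rho>)"
  have m: "(1 / 4) ^ m < \<rho>"
    unfolding m_def using real_arch_pow_inv[OF assms(1), of "1 / 4"]
    by (intro LeastI_ex[of "\<lambda>n. (1 / 4) ^ n < \<rho>"]) simp
  then obtain k where k: "m = Suc k" using assms(2) by (cases m) auto
  then have "\<not> (1 / 4) ^ k < \<rho>" using not_less_Least[of k "\<lambda>n. (1 / 4) ^ n < \<rho>"] by (simp add: m_def)
  then show ?thesis using that[of k] m k by simp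
qed

text \<open>Measure zero would give covers of arbitrarily small cost. Thickening to open sets adds
  little, compactness leaves finitely many, and rounding diameters up to powers of
  \<open>1 / 4\<close> loses a factor of at most \<open>4 powr s'\<close>.\<close>

lemma hausdorff_measure_nonzero:
  fixes E :: "'a::metric_space set"
  assumes "compact E" "0 \<le> s" "s < s'" "0 < \<kappa>"
    and cov: "\<And>(V :: nat \<Rightarrow> 'a set) k I. finite I \<Longrightarrow> E \<subseteq> (\<Union>i\<in>I. V i) \<Longrightarrow>
       (\<And>i p q. i \<in> I \<Longrightarrow> p \<in> V i \<Longrightarrow> q \<in> V i \<Longrightarrow> dist p q \<le> (1 / 4) ^ k i) \<Longrightarrow>
       \<kappa> \<le> (\<Sum>i\<in>I. (1 / 4 powr s') ^ k i)"
  shows "hausdorff_measure s E \<noteq> 0"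
proof
  assume zero: "hausdorff_measure s E = 0"
  have s': "0 < s'" using assms by simp
  \<comment> \<open>The bound \<open>1 / 2\<close> keeps the thickened diameters at most 1; the
    other one brings the final cost below \<open>\<kappa>\<close>.\<close>
  define \<epsilon> where "\<epsilon> = min (1 / 2) (\<kappa> / (4 * 4 powr s'))"
  have \<epsilon>: "0 < \<epsilon>" "\<epsilon> \<le> 1 / 2" "4 powr s' * (2 * \<epsilon>) < \<kappa>"
  proof -
    show "0 < \<epsilon>" "\<epsilon> \<le> 1 / 2" using assms(4) by (auto simp: \<epsilon>_def)
    have "\<epsilon> \<le> \<kappa> / (4 * 4 powr s')" by (simp add: \<epsilon>_def)
    then have "4 powr s' * (2 * \<epsilon>) \<le> \<kappa> / 2" by (simp add: field_simps)
    then show "4 powr s' * (2 * \<epsilon>) < \<kappa>" using assms(4) by simp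
  qed
  have "hausdorff_premeasure s 1 E \<le> hausdorff_measure s E"
    unfolding hausdorff_measure_def by (intro SUP_upper) auto
  then have "hausdorff_premeasure s 1 E < ennreal \<epsilon>" using zero \<epsilon>(1) by simp
  then obtain U :: "nat \<Rightarrow> 'a set" where U: "E \<subseteq> (\<Union>i. U i)" "\<And>i. bounded (U i)" "\<And>i. diameter (U i) \<le> 1"
    and sum: "(\<Sum>i. diam_pow s (U i)) < ennreal \<epsilon>"
    unfolding hausdorff_premeasure_def INF_less_iff by auto
  define d where "d i = diameter (U i)" for i
  have d: "0 \<le> d i" "d i \<le> 1" for i using U(2,3) by (auto simp: d_def intro: diameter_ge_0)
  \<comment> \<open>Diameters are at most 1, so the larger exponent gives the smaller cost; for
    \<open>s = 0\<close> a nonempty set has weight 1, which dominates as well.\<close>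
  have le: "ennreal (d i powr s') \<le> diam_pow s (U i)" for i
  proof (cases "U i = {}")
    case True
    then show ?thesis using s' by (simp add: d_def)
  next
    case False
    have "d i powr s' \<le> d i powr s" if "s \<noteq> 0"
      using d[of i] assms(2,3) that by (cases "d i = 0") (auto intro: powr_mono')
    moreover have "d i powr s' \<le> 1" using d[of i] s' by (intro powr_le1) auto
    ultimately show ?thesis
      using False by (auto simp: diam_pow_def d_def intro: ennreal_leI simp flip: ennreal_1)
  qed
  have part: "(\<Sum>i\<in>I. d i powr s') \<le> \<epsilon>" if "finite I" for I
  proof -
    have "ennreal (\<Sum>i\<in>I. d i powr s') = (\<Sum>i\<in>I. ennreal (d i powr s'))" by (simp add: sum_ennreal)
    also have "\<dots> \<le> (\<Sum>i\<in>I. diam_pow s (U i))" by (intro sum_mono le)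
    also have "\<dots> \<le> (\<Sum>i. diam_pow s (U i))" using that by (intro sum_le_suminf) auto
    also have "\<dots> \<le> ennreal \<epsilon>" using sum by simp
    finally show ?thesis using \<epsilon>(1) by (subst (asm) ennreal_le_iff) auto
  qed
  \<comment> \<open>Positive margins of total at most \<open>\<epsilon>\<close>, so that sets of
    diameter 0 can be thickened too.\<close>
  define \<eta> where "\<eta> i = \<epsilon> * (1 / 2) ^ Suc i" for i
  have \<eta>: "0 < \<eta> i" "\<eta> i \<le> \<epsilon>" for i
    using \<epsilon>(1) by (auto simp: \<eta>_def mult_le_cancel_left1 power_le_one simp del: power_Suc)
  have \<eta>sum: "(\<Sum>i\<in>I. \<eta> i) \<le> \<epsilon>" if "finite I" for I
  proof -
    have "(\<Sum>i\<in>I. (1 / 2 :: real) ^ Suc i) \<le> (\<Sum>i. (1 / 2) ^ Suc i)"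
      using that power_half_series by (intro sum_le_suminf) (auto simp: sums_iff)
    also have "\<dots> = 1" using power_half_series by (simp add: sums_iff)
    finally show ?thesis
      using \<epsilon>(1) by (simp add: \<eta>_def mult_left_le flip: sum_distrib_left del: power_Suc)
  qed
  define \<rho> where "\<rho> i = (d i powr s' + \<eta> i) powr (1 / s')" for i
  have \<rho>s: "\<rho> i powr s' = d i powr s' + \<eta> i" for i
    using s' \<eta>(1)[of i] by (simp add: \<rho>_def powr_powr add_nonneg_pos)
  have \<rho>: "d i < \<rho> i" "0 < \<rho> i" "\<rho> i \<le> 1" for i
  proof -
    show "0 < \<rho> i" using \<eta>(1)[of i] by (simp add: \<rho>_def) (metis add_nonneg_pos less_irrefl powr_ge_zero)
    show "d i < \<rho> i"
    proof (rule ccontr)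
      assume "\<not> d i < \<rho> i"
      then have "\<rho> i powr s' \<le> d i powr s'" using \<open>0 < \<rho> i\<close> s' by (intro powr_mono2) auto
      then show False using \<rho>s[of i] \<eta>(1)[of i] by simp
    qed
    have "d i powr s' + \<eta> i \<le> 1" using part[of "{i}"] \<eta>(2)[of i] \<epsilon>(2) by simp
    then show "\<rho> i \<le> 1" using s' \<eta>(1)[of i] unfolding \<rho>_def by (intro powr_le1) auto
  qed
  have "\<exists>k. \<rho> i \<le> (1 / 4) ^ k \<and> (1 / 4) ^ k \<le> 4 * \<rho> i" for i
    using four_adic_scale[OF \<rho>(2,3)] by metis
  then obtain k where k: "\<And>i. \<rho> i \<le> (1 / 4) ^ k i" "\<And>i. (1 / 4) ^ k i \<le> 4 * \<rho> i" by metis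
  \<comment> \<open>The radius is half the gap, which keeps distances inside \<open>V i\<close> at
    most \<open>\<rho> i\<close>.\<close>
  define V where "V i = (\<Union>u\<in>U i. ball u ((\<rho> i - d i) / 2))" for i
  have "E \<subseteq> (\<Union>i\<in>UNIV. V i)"
  proof
    fix x assume "x \<in> E"
    then obtain i where "x \<in> U i" using U(1) by blast
    then show "x \<in> (\<Union>i\<in>UNIV. V i)" using \<rho>(1)[of i] by (auto simp: V_def intro!: exI[of _ i] bexI[of _ x])
  qed
  moreover have "\<And>i. i \<in> UNIV \<Longrightarrow> open (V i)" by (simp add: V_def open_UN)
  ultimately obtain I where I: "finite I" "E \<subseteq> (\<Union>i\<in>I. V i)"
    using compactE_image[OF assms(1), of UNIV V] by metis
  have "dist p q \<le> (1 / 4) ^ k i" if pq: "p \<in> V i" "q \<in> V i" for p q i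
  proof -
    obtain u v where uv: "u \<in> U i" "v \<in> U i" "dist u p < (\<rho> i - d i) / 2" "dist v q < (\<rho> i - d i) / 2"
      using pq by (auto simp: V_def)
    have "dist u v \<le> d i" unfolding d_def by (intro diameter_bounded_bound U(2) uv)
    moreover have "dist p q \<le> dist u p + dist u v + dist v q"
      using dist_triangle[of p q u] dist_triangle[of u q v] by (simp add: dist_commute)
    ultimately have "dist p q \<le> \<rho> i" using uv(3,4) by argo
    then show ?thesis using k(1)[of i] by simp
  qed
  then have "\<kappa> \<le> (\<Sum>i\<in>I. (1 / 4 powr s') ^ k i)" by (intro cov[OF I]) auto
  also have "\<dots> \<le> (\<Sum>i\<in>I. 4 powr s' * (d i powr s' + \<eta> i))"
  proof (intro sum_mono)
    fix i
    have "(1 / 4 powr s') ^ k i = ((1 / 4) ^ k i) powr s'"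
      by (simp add: powr_realpow[symmetric] powr_powr powr_divide mult.commute)
    also have "\<dots> \<le> (4 * \<rho> i) powr s'" using k(2)[of i] s' by (intro powr_mono2) auto
    also have "\<dots> = 4 powr s' * (d i powr s' + \<eta> i)" using \<rho>(2)[of i] by (simp add: powr_mult \<rho>s)
    finally show "(1 / 4 powr s') ^ k i \<le> 4 powr s' * (d i powr s' + \<eta> i)" .
  qed
  also have "\<dots> = 4 powr s' * ((\<Sum>i\<in>I. d i powr s') + (\<Sum>i\<in>I. \<eta> i))"
    by (simp add: sum_distrib_left sum.distrib distrib_left)
  also have "\<dots> \<le> 4 powr s' * (2 * \<epsilon>)" using part[OF I(1)] \<eta>sum[OF I(1)] by (intro mult_left_mono) auto
  finally show False using \<epsilon>(3) by simp
qed

section \<open>Compactness of the segment set, and the conclusion from the two estimates\<close>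

lemma compact_segment_set:
  assumes "compact K"
  shows "compact (segment_set K)"
proof -
  have "segment_set K = (\<lambda>(x, c1, c2). (x, (1 - x) * c1 + x * c2 / 2)) ` (K \<times> cantor_set \<times> cantor_set)"
    (is "_ = ?f ` _")
  proof (intro equalityI subsetI)
    fix P assume "P \<in> segment_set K"
    then obtain x c1 c2 where "P = ?f (x, c1, c2)" "(x, c1, c2) \<in> K \<times> cantor_set \<times> cantor_set"
      by (auto simp: segment_set_def)
    then show "P \<in> ?f ` (K \<times> cantor_set \<times> cantor_set)" by (rule image_eqI)
  qed (auto simp: segment_set_def)
  moreover have "compact ((\<lambda>(x, c1, c2). (x, (1 - x) * c1 + x * c2 / 2)) ` (K \<times> cantor_set \<times> cantor_set))"
    unfolding case_prod_unfold
    by (intro compact_continuous_image compact_Times assms compact_cantor_set continuous_intros) auto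
  ultimately show ?thesis by simp
qed

lemma frostman_weight_mass:
  assumes "frostman_weight \<theta> n S w" "0 \<le> \<theta>"
  shows "(\<Sum>x\<in>S. w x) \<le> 3"
proof -
  have S: "S \<subseteq> {0..1}" using assms(1) by (simp add: frostman_weight_def)
  have "(\<Sum>x\<in>S. w x) \<le> (1 + 2) * \<theta> ^ 0"
  proof (rule frostman_weight_interval[OF assms(1)])
    fix x y assume "x \<in> S" "y \<in> S"
    then have "x \<in> {0..1}" "y \<in> {0..1}" using S by blast+
    then show "4 ^ 0 * \<bar>x - y\<bar> \<le> 1" by (auto simp: abs_le_iff)
  qed (use assms(2) in auto)
  then show ?thesis by simp
qed

theorem theorem1:
  fixes \<alpha> :: real and K :: "real set"
  assumes "0 < \<alpha>" and "\<alpha> < 1"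
    and "K \<subseteq> {0..1}" and "compact K"
    and "ereal \<alpha> \<le> hausdorff_dim K"
  shows "ereal (ln (8 / 3) / ln 16 + 3 * \<alpha> / 2) \<le> hausdorff_dim (segment_set K)"
  unfolding hausdorff_dim_def
proof (rule INF_greatest)
  define c where "c = ln (8 / 3 :: real) / ln 16"
  fix s assume "s \<in> {s. 0 \<le> s \<and> hausdorff_measure s (segment_set K) = 0}"
  then have s: "0 \<le> s" "hausdorff_measure s (segment_set K) = 0" by auto
  have "c + 3 * \<alpha> / 2 \<le> s"
  proof (rule ccontr)
    assume "\<not> c + 3 * \<alpha> / 2 \<le> s"
    \<comment> \<open>The strict inequality leaves room for \<open>s'\<close> above
      \<open>s\<close>, and then for \<open>a\<close> below \<open>\<alpha>\<close> with
      \<open>s' < c + 3 * a / 2\<close>.\<close>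
    then obtain s' where s': "s < s'" "s' < c + 3 * \<alpha> / 2" using dense not_le by metis
    then have "max 0 (2 / 3 * (s' - c)) < \<alpha>" using assms(1) by auto
    then obtain a where a: "0 < a" "2 / 3 * (s' - c) < a" "a < \<alpha>"
      using dense[of "max 0 (2 / 3 * (s' - c))" \<alpha>] by auto
    define \<theta> \<sigma> where "\<theta> = 4 powr (- a)" and "\<sigma> = 4 powr s'"
    have \<theta>: "1 / 4 < \<theta>" "0 < \<theta>" "0 < \<sigma>" "\<theta> < 1"
    proof -
      have "4 powr (- 1) < 4 powr (- a)" using a assms(2) by (intro powr_less_mono) auto
      then show "1 / 4 < \<theta>" by (simp add: \<theta>_def powr_minus_divide)
      have "4 powr (- a) < 4 powr 0" using a by (intro powr_less_mono) auto
      then show "\<theta> < 1" by (simp add: \<theta>_def)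
    qed (simp_all add: \<theta>_def \<sigma>_def)
    have "ereal a < hausdorff_dim K" using a(3) assms(5) by (meson ereal_less_le less_ereal.simps(1) order.strict_trans2)
    then obtain \<kappa> where \<kappa>: "0 < \<kappa>" "content_ge \<theta> \<kappa> K"
      unfolding \<theta>_def using content_ge_if_dim[OF a(1)] by blast
    \<comment> \<open>Both cases end here, with their own decay rate \<open>g\<close> and part
      \<open>K'\<close> of \<open>K\<close>; a cover of the whole set covers the part over
      \<open>K'\<close>.\<close>
    have finish: False if "0 < \<kappa>'" "0 < C" "0 \<le> g" "\<sigma> * \<theta> * g < 1" "K' \<subseteq> K"
      "\<And>n. \<exists>S w. frostman_weight \<theta> n S w \<and> S \<subseteq> K' \<and> \<kappa>' \<le> (\<Sum>x\<in>S. w x) \<and>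
        (\<forall>k\<le>n. (\<Sum>x\<in>S. w x * card (quads n k x)) \<le> C * 16 ^ n * g ^ k)" for \<kappa>' C g K'
    proof -
      have "segment_set K' \<subseteq> segment_set K" using that(5) by (auto simp: segment_set_def)
      then have "hausdorff_measure s (segment_set K) \<noteq> 0"
      proof (intro hausdorff_measure_nonzero[OF compact_segment_set[OF assms(4)] s(1) s'(1)])
        show "0 < \<kappa>'\<^sup>2 * (1 - \<sigma> * \<theta> * g) / (4 * C)" using that by simp
        fix V :: "nat \<Rightarrow> (real \<times> real) set" and k :: "nat \<Rightarrow> nat" and I
        assume V: "finite I" "segment_set K \<subseteq> (\<Union>i\<in>I. V i)"
          "\<And>i p q. i \<in> I \<Longrightarrow> p \<in> V i \<Longrightarrow> q \<in> V i \<Longrightarrow> dist p q \<le> (1 / 4) ^ k i"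
        show "\<kappa>'\<^sup>2 * (1 - \<sigma> * \<theta> * g) / (4 * C) \<le> (\<Sum>i\<in>I. (1 / 4 powr s') ^ k i)"
          unfolding \<sigma>_def[symmetric]
        proof (rule segment_set_cover_bound[OF that(6,1,2) _ that(3) \<theta>(3) that(4) V(1) _ V(3)])
          show "segment_set K' \<subseteq> (\<Union>i\<in>I. V i)" using V(2) \<open>segment_set K' \<subseteq> segment_set K\<close> by blast
        qed (use \<theta> in auto)
      qed
      then show False using s(2) by simp
    qed
    \<comment> \<open>The two convergence ratios multiply to
      \<open>3 / 8 * 4 powr (2 * s' - 3 * a)\<close>, which is below 1 since
      \<open>4 powr (2 * c) = 8 / 3\<close>; so one ratio is below 1. This averages the exponents
      \<open>a + 2 * c\<close> and \<open>2 * a\<close>.\<close>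
    have "(\<sigma> * \<theta> * (3 / 8)) * (\<sigma> * \<theta> * \<theta>) < 1"
    proof -
      have "ln (16::real) = 2 * ln 4" using ln_realpow[of 4 2] by simp
      then have "2 * c * ln 4 = ln (8 / 3)" by (simp add: c_def)
      then have "4 powr (2 * c) = 8 / 3" by (simp add: powr_def)
      moreover have "4 powr (2 * s' - 3 * a) < 4 powr (2 * c)" using a(2) by (intro powr_less_mono) auto
      moreover have "\<sigma> * \<sigma> * (\<theta> * \<theta> * \<theta>) = 4 powr (2 * s' - 3 * a)"
        by (simp add: \<sigma>_def \<theta>_def flip: powr_add)
      ultimately have "\<sigma> * \<sigma> * (\<theta> * \<theta> * \<theta>) < 8 / 3" by linarith
      moreover have "(\<sigma> * \<theta> * (3 / 8)) * (\<sigma> * \<theta> * \<theta>) = 3 / 8 * (\<sigma> * \<sigma> * (\<theta> * \<theta> * \<theta>))"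
        by simp
      ultimately show ?thesis by linarith
    qed
    then consider "\<sigma> * \<theta> * (3 / 8) < 1" | "\<sigma> * \<theta> * \<theta> < 1"
      by (meson linorder_not_less mult_ge1_I)
    then show False
    proof cases
      case 1
      \<comment> \<open>Trimming the ends costs \<open>3 * \<theta> ^ m\<close>, less than half of
        \<open>\<kappa>\<close>.\<close>
      have "\<exists>m. \<theta> ^ m < \<kappa> / 6" using real_arch_pow_inv[of "\<kappa> / 6" \<theta>] \<kappa>(1) \<theta> by simp
      then obtain m where m: "\<theta> ^ m < \<kappa> / 6" by blast
      define \<eta> where "\<eta> = (1 / 4 :: real) ^ m"
      define K' where "K' = K \<inter> {\<eta> .. 1 - \<eta>}"
      have \<eta>: "0 < \<eta>" by (simp add: \<eta>_def)
      have K': "content_ge \<theta> (\<kappa> - 3 * \<theta> ^ m) K'"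
        unfolding K'_def \<eta>_def using \<kappa>(2) assms(3) \<theta>(2) by (rule content_ge_interior)
      have sub: "K' \<subseteq> {0..1}" using assms(3) by (auto simp: K'_def)
      show False
      proof (rule finish[OF _ _ _ 1])
        show "0 < \<kappa> - 3 * \<theta> ^ m" using m \<kappa>(1) by simp
        \<comment> \<open>The pointwise constant times the bound 3 on the total weight.\<close>
        show "0 < 3 * (12 / \<eta> + 1)" using \<eta> by (simp add: add_pos_pos)
        fix n
        obtain S w where fw: "frostman_weight \<theta> n S w" "S \<subseteq> K'" "\<kappa> - 3 * \<theta> ^ m \<le> (\<Sum>x\<in>S. w x)"
          using ex_frostman_weight[OF K' sub \<theta>(2)] by blast
        have "(\<Sum>x\<in>S. w x * card (quads n k x)) \<le> 3 * (12 / \<eta> + 1) * 16 ^ n * (3 / 8) ^ k" if "k \<le> n" for k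
        proof -
          have "(\<Sum>x\<in>S. w x * card (quads n k x)) \<le> (\<Sum>x\<in>S. w x * ((12 / \<eta> + 1) * 16 ^ n * (3 / 8) ^ k))"
            using fw that \<eta>
            by (intro sum_mono mult_left_mono card_quads_interior) (auto simp: K'_def frostman_weight_def)
          also have "\<dots> = (\<Sum>x\<in>S. w x) * ((12 / \<eta> + 1) * 16 ^ n * (3 / 8) ^ k)"
            by (simp only: sum_distrib_right)
          also have "\<dots> \<le> 3 * ((12 / \<eta> + 1) * 16 ^ n * (3 / 8) ^ k)"
            using frostman_weight_mass[OF fw(1)] \<theta> \<eta> by (intro mult_right_mono) auto
          finally show ?thesis by (simp only: mult.assoc)
        qed
        then show "\<exists>S w. frostman_weight \<theta> n S w \<and> S \<subseteq> K' \<and> \<kappa> - 3 * \<theta> ^ m \<le> (\<Sum>x\<in>S. w x) \<and>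
            (\<forall>k\<le>n. (\<Sum>x\<in>S. w x * card (quads n k x)) \<le> 3 * (12 / \<eta> + 1) * 16 ^ n * (3 / 8) ^ k)"
          using fw by blast
      qed (auto simp: K'_def)
    next
      case 2
      show False
      proof (rule finish[OF \<kappa>(1) _ _ 2])
        show "0 < 34 / (1 - 1 / (4 * \<theta>))" using \<theta> by (simp add: field_simps)
        fix n
        show "\<exists>S w. frostman_weight \<theta> n S w \<and> S \<subseteq> K \<and> \<kappa> \<le> (\<Sum>x\<in>S. w x) \<and>
            (\<forall>k\<le>n. (\<Sum>x\<in>S. w x * card (quads n k x)) \<le> 34 / (1 - 1 / (4 * \<theta>)) * 16 ^ n * \<theta> ^ k)"
          using ex_frostman_weight[OF \<kappa>(2) assms(3) \<theta>(2), of n] frostman_weight_quads[OF _ \<theta>(1)] by blast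
      qed (use \<theta> in auto)
    qed
  qed
  then show "ereal (ln (8 / 3) / ln 16 + 3 * \<alpha> / 2) \<le> ereal s" by (simp add: c_def)
qed

end
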